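(* Let $F_1,\dots,F_k$ be smooth, Lipschitz-continuous vector fields on $\mathbb{R}^n$, let $\mathcal{U}:=L^2([0,1],\mathbb{R}^k)$, and let $\beta>0$. Let $a:\mathbb{R}^n\times\mathbb{R}^n\to[0,+\infty)$ be a $C^1$-regular non-negative function, and let $(\gamma_N)_{N\ge1}\subset\mathcal{P}(\mathbb{R}^n\times\mathbb{R}^n)$ be a sequence of probability measures such that $\gamma_N\rightharpoonup^*\gamma_\infty$ as $N\to\infty$. Assume that there exists a compact set $K\subset\mathbb{R}^n$ with $\mathrm{supp}(\gamma_N)\subset K\times K$ for every $N\in\mathbb{N}\cup\{\infty\}$. For every $N\in\mathbb{N}\cup\{\infty\}$ let $$\mathcal{F}^{N,\beta}(u):=\int_{\mathbb{R}^n\times\mathbb{R}^n}a(\Phi_u(x),y)\,d\gamma_N(x,y)+\frac\beta2\|u\|_{L^2}^2,$$ restricted to the bounded subset $\mathcal{U}_\beta\subset\mathcal{U}$. Then, equipping $\mathcal{U}_\beta$ with the weak topology of $L^2$, we have $\mathcal{F}^{N,\beta}\to_\Gamma\mathcal{F}^{\infty,\beta}$ as $N\to\infty$.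
   Context: Flow: for $u=(u_1,\dots,u_k)\in\mathcal{U}$, $\Phi_u:\mathbb{R}^n\to\mathbb{R}^n$ is defined by $\Phi_u(x):=x_u(1)$, where $x_u:[0,1]\to\mathbb{R}^n$ is the absolutely continuous solution of $\dot x_u(t)=\sum_{i=1}^kF_i(x_u(t))u_i(t)$ for a.e. $t\in[0,1]$, $x_u(0)=x$. $\rightharpoonup^*$ denotes convergence of probability measures tested against bounded continuous functions. Here $\mathbb{N}=\{1,2,\dots\}$. $\mathcal{U}_\beta:=\{u\in\mathcal{U}:\|u\|_{L^2}^2\le C/\beta\}$, where $C>0$ is a constant such that, for every $N\in\mathbb{N}\cup\{\infty\}$, every minimizer $\hat u$ of $\mathcal{F}^{N,\beta}$ over $\mathcal{U}$ satisfies $\|\hat u\|_{L^2}^2\le C/\beta$ (such a constant exists). The weak topology of $L^2$ is metrizable on $\mathcal{U}_\beta$. $\Gamma$-convergence: on a metric space $\mathcal{X}$, functionals $\mathcal{G}^N$ $\Gamma$-converge to $\mathcal{G}^\infty$ ($\mathcal{G}^N\to_\Gamma\mathcal{G}^\infty$) if (liminf) for every $u_N\to u$ in $\mathcal{X}$ one has $\mathcal{G}^\infty(u)\le\liminf_N\mathcal{G}^N(u_N)$, and (limsup) for every $u\in\mathcal{X}$ there exists $u_N\to u$ in $\mathcal{X}$ with $\mathcal{G}^\infty(u)\ge\limsup_N\mathcal{G}^N(u_N)$. *)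

theory Defs
  imports "HOL-Probability.Probability" "HOL-Library.Extended_Nat"
begin

section \<open>The Hilbert space of square-integrable maps on the unit interval\<close>

definition sq_integrable :: "(real \<Rightarrow> 'b::euclidean_space) \<Rightarrow> bool" where
  "sq_integrable f \<longleftrightarrow> f \<in> borel_measurable (lebesgue_on {0..1}) \<and>
     integrable (lebesgue_on {0..1}) (\<lambda>t. (norm (f t))\<^sup>2)"

definition L2_rel :: "(real \<Rightarrow> 'b::euclidean_space) \<Rightarrow> (real \<Rightarrow> 'b) \<Rightarrow> bool" where
  "L2_rel f g \<longleftrightarrow> sq_integrable f \<and> sq_integrable g \<and> (AE t in lebesgue_on {0..1}. f t = g t)"

lemma sq_integrable_zero: "sq_integrable (\<lambda>_. 0)"
  by (simp add: sq_integrable_def)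

lemma sq_integrable_integrable_inner:
  assumes "sq_integrable f" "sq_integrable g"
  shows "integrable (lebesgue_on {0..1}) (\<lambda>t. f t \<bullet> g t)"
proof (rule Bochner_Integration.integrable_bound)
  show "integrable (lebesgue_on {0..1}) (\<lambda>t. (norm (f t))\<^sup>2 + (norm (g t))\<^sup>2)"
    using assms by (simp add: sq_integrable_def)
  show "(\<lambda>t. f t \<bullet> g t) \<in> borel_measurable (lebesgue_on {0..1})"
    using assms by (intro borel_measurable_inner) (auto simp: sq_integrable_def)
  have "norm (f t \<bullet> g t) \<le> norm ((norm (f t))\<^sup>2 + (norm (g t))\<^sup>2)" for t
  proof -
    have "\<bar>f t \<bullet> g t\<bar> \<le> norm (f t) * norm (g t)" by (rule Cauchy_Schwarz_ineq2)
    also have "\<dots> \<le> 2 * norm (f t) * norm (g t)" by simp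
    also have "\<dots> \<le> (norm (f t))\<^sup>2 + (norm (g t))\<^sup>2" by (rule sum_squares_bound)
    finally show ?thesis by simp
  qed
  then show "AE t in lebesgue_on {0..1}. norm (f t \<bullet> g t) \<le> norm ((norm (f t))\<^sup>2 + (norm (g t))\<^sup>2)"
    by simp
qed

lemma sq_integrable_add:
  assumes "sq_integrable f" "sq_integrable g"
  shows "sq_integrable (\<lambda>t. f t + g t)"
proof -
  have "(norm (f t + g t))\<^sup>2 = (norm (f t))\<^sup>2 + 2 * (f t \<bullet> g t) + (norm (g t))\<^sup>2" for t
    by (simp only: power2_norm_eq_inner inner_add_left inner_add_right inner_commute[of "g t" "f t"])
  then show ?thesis
    using assms sq_integrable_integrable_inner[OF assms]
    by (simp add: sq_integrable_def borel_measurable_add)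
qed

lemma sq_integrable_scaleR:
  assumes "sq_integrable f" shows "sq_integrable (\<lambda>t. c *\<^sub>R f t)"
  using assms by (auto simp: sq_integrable_def power_mult_distrib)

lemma sq_integrable_minus:
  assumes "sq_integrable f" shows "sq_integrable (\<lambda>t. - f t)"
  using sq_integrable_scaleR[OF assms, of "-1"] by simp

lemma sq_integrable_diff:
  assumes "sq_integrable f" "sq_integrable g"
  shows "sq_integrable (\<lambda>t. f t - g t)"
  using sq_integrable_add[OF assms(1) sq_integrable_minus[OF assms(2)]] by simp

lemma L2_rel_sym: "L2_rel f g \<Longrightarrow> L2_rel g f"
  by (auto simp: L2_rel_def elim: eventually_mono)

lemma L2_rel_trans:
  assumes "L2_rel f g" "L2_rel g h" shows "L2_rel f h"
proof -
  have "AE t in lebesgue_on {0..1}. f t = g t" "AE t in lebesgue_on {0..1}. g t = h t"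
    using assms by (simp_all add: L2_rel_def)
  then have "AE t in lebesgue_on {0..1}. f t = h t" by eventually_elim simp
  with assms show ?thesis by (simp add: L2_rel_def)
qed

quotient_type (overloaded) 'b L2 = "real \<Rightarrow> 'b::euclidean_space" / partial: "L2_rel"
proof (rule part_equivpI)
  show "\<exists>f. L2_rel f f"
    using sq_integrable_zero by (auto simp: L2_rel_def)
  show "symp L2_rel" by (rule sympI) (rule L2_rel_sym)
  show "transp L2_rel" by (rule transpI) (rule L2_rel_trans)
qed

lemmas sq_integrable_simps =
  sq_integrable_zero sq_integrable_add sq_integrable_minus sq_integrable_diff sq_integrable_scaleR

lemma L2_rel_eqI:
  assumes "sq_integrable f" "\<And>t. f t = g t" shows "L2_rel f g"
proof -
  have "g = f" using assms(2) by auto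
  with assms(1) show ?thesis by (simp add: L2_rel_def)
qed

lemma L2_rel_map2:
  assumes r: "L2_rel f f'" "L2_rel g g'"
    and "sq_integrable (\<lambda>t. h (f t) (g t))" "sq_integrable (\<lambda>t. h (f' t) (g' t))"
  shows "L2_rel (\<lambda>t. h (f t) (g t)) (\<lambda>t. h (f' t) (g' t))"
proof -
  have "AE t in lebesgue_on {0..1}. f t = f' t" "AE t in lebesgue_on {0..1}. g t = g' t"
    using r by (simp_all add: L2_rel_def)
  then have "AE t in lebesgue_on {0..1}. h (f t) (g t) = h (f' t) (g' t)"
    by eventually_elim simp
  with assms show ?thesis by (simp add: L2_rel_def)
qed

instantiation L2 :: (euclidean_space) real_inner
begin

lift_definition zero_L2 :: "'a L2" is "\<lambda>_. 0"
  by (simp add: L2_rel_def sq_integrable_zero)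

lift_definition plus_L2 :: "'a L2 \<Rightarrow> 'a L2 \<Rightarrow> 'a L2" is "\<lambda>f g t. f t + g t"
  by (rule L2_rel_map2[where h = "(+)"]) (simp_all add: L2_rel_def sq_integrable_add)

lift_definition minus_L2 :: "'a L2 \<Rightarrow> 'a L2 \<Rightarrow> 'a L2" is "\<lambda>f g t. f t - g t"
  by (rule L2_rel_map2[where h = "(-)"]) (simp_all add: L2_rel_def sq_integrable_diff)

lift_definition uminus_L2 :: "'a L2 \<Rightarrow> 'a L2" is "\<lambda>f t. - f t"
  subgoal for f g by (rule L2_rel_map2[where h = "\<lambda>x _. - x" and g = f and g' = g]) (simp_all add: L2_rel_def sq_integrable_minus)
  done

lift_definition scaleR_L2 :: "real \<Rightarrow> 'a L2 \<Rightarrow> 'a L2" is "\<lambda>c f t. c *\<^sub>R f t"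
  subgoal for c f g by (rule L2_rel_map2[where h = "\<lambda>x _. c *\<^sub>R x" and g = f and g' = g]) (simp_all add: L2_rel_def sq_integrable_scaleR)
  done

lift_definition inner_L2 :: "'a L2 \<Rightarrow> 'a L2 \<Rightarrow> real"
  is "\<lambda>f g. LINT t|lebesgue_on {0..1}. f t \<bullet> g t"
proof (rule Bochner_Integration.integral_cong_AE)
  fix f f' g g' :: "real \<Rightarrow> 'a" assume r: "L2_rel f f'" "L2_rel g g'"
  show "(\<lambda>t. f t \<bullet> g t) \<in> borel_measurable (lebesgue_on {0..1})"
    "(\<lambda>t. f' t \<bullet> g' t) \<in> borel_measurable (lebesgue_on {0..1})"
    using r by (auto simp: L2_rel_def sq_integrable_def intro: borel_measurable_inner)
  have "AE t in lebesgue_on {0..1}. f t = f' t" "AE t in lebesgue_on {0..1}. g t = g' t"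
    using r by (simp_all add: L2_rel_def)
  then show "AE t in lebesgue_on {0..1}. f t \<bullet> g t = f' t \<bullet> g' t"
    by eventually_elim simp
qed

definition norm_L2 :: "'a L2 \<Rightarrow> real" where
  "norm_L2 u = sqrt (u \<bullet> u)"

definition sgn_L2 :: "'a L2 \<Rightarrow> 'a L2" where
  "sgn_L2 u = inverse (norm u) *\<^sub>R u"

definition dist_L2 :: "'a L2 \<Rightarrow> 'a L2 \<Rightarrow> real" where
  "dist_L2 u v = norm (u - v)"

definition uniformity_L2 :: "('a L2 \<times> 'a L2) filter" where
  "uniformity_L2 = (INF e\<in>{0<..}. principal {(u, v). dist u v < e})"

definition open_L2 :: "'a L2 set \<Rightarrow> bool" where
  "open_L2 U \<longleftrightarrow> (\<forall>u\<in>U. \<forall>\<^sub>F (u', v) in uniformity. u' = u \<longrightarrow> v \<in> U)"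

instance
proof
  fix u v w :: "'a L2" and r s :: real and U :: "'a L2 set"
  show "u + v + w = u + (v + w)"
    by transfer (rule L2_rel_eqI, (simp add: L2_rel_def sq_integrable_simps; fail), simp add: algebra_simps)
  show "u + v = v + u"
    by transfer (rule L2_rel_eqI, (simp add: L2_rel_def sq_integrable_simps; fail), simp add: algebra_simps)
  show "0 + u = u"
    by transfer (rule L2_rel_eqI, (simp add: L2_rel_def sq_integrable_simps; fail), simp add: algebra_simps)
  show "- u + u = 0"
    by transfer (rule L2_rel_eqI, (simp add: L2_rel_def sq_integrable_simps; fail), simp add: algebra_simps)
  show "u - v = u + - v"
    by transfer (rule L2_rel_eqI, (simp add: L2_rel_def sq_integrable_simps; fail), simp add: algebra_simps)
  show "r *\<^sub>R (u + v) = r *\<^sub>R u + r *\<^sub>R v"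
    by transfer (rule L2_rel_eqI, (simp add: L2_rel_def sq_integrable_simps; fail), simp add: algebra_simps)
  show "(r + s) *\<^sub>R u = r *\<^sub>R u + s *\<^sub>R u"
    by transfer (rule L2_rel_eqI, (simp add: L2_rel_def sq_integrable_simps; fail), simp add: algebra_simps)
  show "r *\<^sub>R s *\<^sub>R u = (r * s) *\<^sub>R u"
    by transfer (rule L2_rel_eqI, (simp add: L2_rel_def sq_integrable_simps; fail), simp add: algebra_simps)
  show "1 *\<^sub>R u = u"
    by transfer (rule L2_rel_eqI, (simp add: L2_rel_def sq_integrable_simps; fail), simp add: algebra_simps)
  show "sgn u = inverse (norm u) *\<^sub>R u" by (rule sgn_L2_def)
  show "dist u v = norm (u - v)" by (rule dist_L2_def)
  show "(uniformity :: ('a L2 \<times> 'a L2) filter) = (INF e\<in>{0<..}. principal {(u, v). dist u v < e})"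
    by (rule uniformity_L2_def)
  show "open U \<longleftrightarrow> (\<forall>u\<in>U. \<forall>\<^sub>F (u', v) in uniformity. u' = u \<longrightarrow> v \<in> U)"
    by (rule open_L2_def)
  show "u \<bullet> v = v \<bullet> u"
    by transfer (simp add: inner_commute)
  show "(u + v) \<bullet> w = u \<bullet> w + v \<bullet> w"
    by transfer (simp add: L2_rel_def inner_add_left sq_integrable_integrable_inner)
  show "(r *\<^sub>R u) \<bullet> v = r * (u \<bullet> v)"
    by transfer simp
  show "0 \<le> u \<bullet> u"
    by transfer simp
  show "u \<bullet> u = 0 \<longleftrightarrow> u = 0"
  proof transfer
    fix f :: "real \<Rightarrow> 'a" assume "L2_rel f f"
    then have f: "sq_integrable f" by (simp add: L2_rel_def)
    have "(LINT t|lebesgue_on {0..1}. f t \<bullet> f t) = 0 \<longleftrightarrow> (AE t in lebesgue_on {0..1}. f t \<bullet> f t = 0)"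
      by (rule integral_nonneg_eq_0_iff_AE) (use sq_integrable_integrable_inner[OF f f] in auto)
    then show "(LINT t|lebesgue_on {0..1}. f t \<bullet> f t) = 0 \<longleftrightarrow> L2_rel f (\<lambda>_. 0)"
      using f by (simp add: L2_rel_def sq_integrable_zero)
  qed
  show "norm u = sqrt (u \<bullet> u)" by (rule norm_L2_def)
qed

end

text \<open>The initial topology for all continuous linear functionals.\<close>

definition weak_topology :: "'a::real_normed_vector topology" where
  "weak_topology =
     pullback_topology UNIV (\<lambda>u (l :: 'a \<Rightarrow>\<^sub>L real). blinfun_apply l u) (powertop_real UNIV)"


section \<open>Gamma-convergence\<close>

text \<open>This is the sequential notion, which is the standard one on metrizable spaces (bounded sets
  of a separable Hilbert space with the weak topology are metrizable).  Only the topology enters.\<close>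

definition gamma_converges ::
    "'a topology \<Rightarrow> (nat \<Rightarrow> 'a \<Rightarrow> ereal) \<Rightarrow> ('a \<Rightarrow> ereal) \<Rightarrow> bool" where
  "gamma_converges X G Ginf \<longleftrightarrow>
     (\<forall>u v. range u \<subseteq> topspace X \<and> limitin X u v sequentially \<longrightarrow>
        Ginf v \<le> liminf (\<lambda>N. G N (u N))) \<and>
     (\<forall>v\<in>topspace X. \<exists>u. range u \<subseteq> topspace X \<and> limitin X u v sequentially \<and>
        limsup (\<lambda>N. G N (u N)) \<le> Ginf v)"


section \<open>Regularity of maps\<close>

text \<open>In finite dimension, \<open>f\<close> is of class \<open>C\<^sup>m\<^sup>+\<^sup>1\<close> iff it is differentiable everywhere and
  all its directional derivatives are of class \<open>C\<^sup>m\<close>.\<close>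

primrec C_k :: "nat \<Rightarrow> ('a::euclidean_space \<Rightarrow> 'b::real_normed_vector) \<Rightarrow> bool" where
  "C_k 0 f \<longleftrightarrow> continuous_on UNIV f"
| "C_k (Suc m) f \<longleftrightarrow> (\<forall>x. f differentiable (at x)) \<and>
     (\<forall>v. C_k m (\<lambda>x. frechet_derivative f (at x) v))"

definition smooth :: "('a::euclidean_space \<Rightarrow> 'b::real_normed_vector) \<Rightarrow> bool" where
  "smooth f \<longleftrightarrow> (\<forall>m. C_k m f)"

definition abs_continuous_on :: "real set \<Rightarrow> (real \<Rightarrow> 'a::real_normed_vector) \<Rightarrow> bool" where
  "abs_continuous_on S f \<longleftrightarrow>
     (\<forall>e>0. \<exists>d>0. \<forall>(m::nat) a b.
        (\<forall>i<m. a i \<le> b i \<and> {a i..b i} \<subseteq> S) \<and>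
        disjoint_family_on (\<lambda>i. {a i<..<b i}) {..<m} \<and>
        (\<Sum>i<m. b i - a i) < d \<longrightarrow>
        (\<Sum>i<m. norm (f (b i) - f (a i))) < e)"


section \<open>Controlled flow and cost\<close>

definition trajectory_fun ::
    "('k::finite \<Rightarrow> 'a::real_normed_vector \<Rightarrow> 'a) \<Rightarrow> (real \<Rightarrow> real ^ 'k) \<Rightarrow> 'a \<Rightarrow> (real \<Rightarrow> 'a) \<Rightarrow> bool" where
  "trajectory_fun F u x X \<longleftrightarrow> abs_continuous_on {0..1} X \<and> X 0 = x \<and>
     (AE t in lebesgue_on {0..1}.
        (X has_vector_derivative (\<Sum>i\<in>UNIV. (u t $ i) *\<^sub>R F i (X t))) (at t within {0..1}))"

lemma trajectory_fun_cong:
  assumes "L2_rel u v" shows "trajectory_fun F u x X \<longleftrightarrow> trajectory_fun F v x X"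
proof -
  have ae: "AE t in lebesgue_on {0..1}. u t = v t" using assms by (simp add: L2_rel_def)
  have "(AE t in lebesgue_on {0..1}. (X has_vector_derivative
            (\<Sum>i\<in>UNIV. (u t $ i) *\<^sub>R F i (X t))) (at t within {0..1})) \<longleftrightarrow>
        (AE t in lebesgue_on {0..1}. (X has_vector_derivative
            (\<Sum>i\<in>UNIV. (v t $ i) *\<^sub>R F i (X t))) (at t within {0..1}))"
    by (rule eventually_cong[OF ae]) simp
  then show ?thesis by (simp add: trajectory_fun_def)
qed

lift_definition trajectory ::
    "('k::finite \<Rightarrow> 'a::real_normed_vector \<Rightarrow> 'a) \<Rightarrow> (real ^ 'k) L2 \<Rightarrow> 'a \<Rightarrow> (real \<Rightarrow> 'a) \<Rightarrow> bool"
  is trajectory_fun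
  by (simp add: trajectory_fun_cong fun_eq_iff)

text \<open>Trajectories are unique only as functions on \<open>[0,1]\<close>; hence the description operator is
  applied to the endpoint and not to the trajectory itself.\<close>

definition flow ::
    "('k::finite \<Rightarrow> 'a::real_normed_vector \<Rightarrow> 'a) \<Rightarrow> (real ^ 'k) L2 \<Rightarrow> 'a \<Rightarrow> 'a" where
  "flow F u x = (THE y. \<exists>X. trajectory F u x X \<and> X 1 = y)"

definition cost ::
    "('k::finite \<Rightarrow> real ^ 'n \<Rightarrow> real ^ 'n) \<Rightarrow> ((real ^ 'n) \<times> (real ^ 'n) \<Rightarrow> real) \<Rightarrow> real \<Rightarrow>
     ((real ^ 'n) \<times> (real ^ 'n)) measure \<Rightarrow> (real ^ 'k) L2 \<Rightarrow> real" where
  "cost F a \<beta> \<gamma> u = (LINT (x, y)|\<gamma>. a (flow F u x, y)) + \<beta> / 2 * (norm u)\<^sup>2"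


section \<open>Borel probability measures\<close>

definition weakly_converges ::
    "(nat \<Rightarrow> 'a::topological_space measure) \<Rightarrow> 'a measure \<Rightarrow> bool" where
  "weakly_converges M M' \<longleftrightarrow>
     (\<forall>f :: 'a \<Rightarrow> real. continuous_on UNIV f \<and> bounded (range f) \<longrightarrow>
        (\<lambda>N. LINT z|M N. f z) \<longlonglongrightarrow> (LINT z|M'. f z))"

definition measure_support :: "'a::topological_space measure \<Rightarrow> 'a set" where
  "measure_support M = {z. \<forall>U. open U \<and> z \<in> U \<longrightarrow> emeasure M U > 0}"

end

theory Submission
  imports Defs
begin

text \<open>
  On \<open>[0,1]\<close> a trajectory is the same thing as a solution of the integral equation, so trajectories
  of two controls \<open>u\<close>, \<open>v\<close> from the same point can be compared by Gronwall's inequality: the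
  difference is controlled by \<open>\<integral>\<^sub>0\<^sup>t \<Sum>\<^sub>i (u\<^sub>i - v\<^sub>i) F\<^sub>i(Y) ds\<close> with \<open>Y\<close> the trajectory of \<open>v\<close>.  This
  is a continuous linear functional of \<open>u - v\<close>, hence it tends to \<open>0\<close> when \<open>u\<close> tends weakly to \<open>v\<close>;
  so the flow at each point is weakly continuous on bounded sets.  The flows of a bounded set of
  controls are equi-Lipschitz, so the convergence is uniform on \<open>K\<close>, and together with the weak
  convergence of the measures the integral part of the cost converges along every weakly
  convergent sequence of controls.  The remaining term \<open>\<parallel>u\<parallel>\<^sup>2\<close> is weakly lower semicontinuous, and
  constant sequences are recovery sequences.
\<close>

section \<open>Absolutely continuous functions\<close>

text \<open>A control is only square-integrable, so its modulus acts as an unbounded time-dependent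
  Lipschitz coefficient, and a trajectory has its derivative only almost everywhere. Hence the
  Lebesgue form of the fundamental theorem, in both directions, underlies every estimate. The
  coefficient enters Gronwall's inequality through its norm in \<open>L2\<close> alone, which is why
  one constant serves the whole ball of controls. Weak convergence survives only in expressions
  linear in the control. The perturbation term therefore stays inside the norm of an integral;
  bounding it by an integral of norms would destroy the cancellation. In the cost, measure and
  integrand vary together, so pointwise convergence of the flows would not suffice; uniformity on
  \<open>K\<close> is what the equi-Lipschitz bound is for. The function \<open>a\<close> may be
  unbounded, while weak convergence of measures tests bounded functions only; a truncation that
  changes nothing on \<open>K \<times> K\<close> reconciles the two.\<close>

lemma abs_continuous_onD:
  fixes f :: "real \<Rightarrow> 'a::real_normed_vector"
  assumes "abs_continuous_on S f" "e > 0"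
  shows "\<exists>d>0. \<forall>(Q :: 'i set) u v. finite Q \<and> (\<forall>i\<in>Q. u i \<le> v i \<and> {u i..v i} \<subseteq> S) \<and>
      disjoint_family_on (\<lambda>i. {u i<..<v i}) Q \<and> (\<Sum>i\<in>Q. v i - u i) < d \<longrightarrow>
      (\<Sum>i\<in>Q. norm (f (v i) - f (u i))) < e"
proof -
  obtain d where "d > 0" and d: "\<And>(m::nat) a b.
        (\<forall>i<m. a i \<le> b i \<and> {a i..b i} \<subseteq> S) \<Longrightarrow>
        disjoint_family_on (\<lambda>i. {a i<..<b i}) {..<m} \<Longrightarrow>
        (\<Sum>i<m. b i - a i) < d \<Longrightarrow>
        (\<Sum>i<m. norm (f (b i) - f (a i))) < e"
    using assms unfolding abs_continuous_on_def by meson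
  show ?thesis
  proof (intro exI[of _ d] conjI allI impI \<open>d > 0\<close>)
    fix Q :: "'i set" and u v
    assume "finite Q \<and> (\<forall>i\<in>Q. u i \<le> v i \<and> {u i..v i} \<subseteq> S) \<and>
      disjoint_family_on (\<lambda>i. {u i<..<v i}) Q \<and> (\<Sum>i\<in>Q. v i - u i) < d"
    then have Q: "finite Q" "\<And>i. i \<in> Q \<Longrightarrow> u i \<le> v i \<and> {u i..v i} \<subseteq> S"
      "disjoint_family_on (\<lambda>i. {u i<..<v i}) Q" "(\<Sum>i\<in>Q. v i - u i) < d"
      by auto
    \<comment> \<open>One \<open>d\<close> serves all families, so reindexing along a bijection
      costs nothing. General index sets are wanted because the pieces of a tagged division form a
      set of pairs.\<close>
    obtain h where h: "bij_betw h {..<card Q} Q"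
      using ex_bij_betw_nat_finite[OF Q(1)] by (metis atLeast0LessThan)
    then have hQ: "h i \<in> Q" if "i < card Q" for i
      using that bij_betw_apply by fastforce
    have "(\<Sum>i<card Q. norm (f (v (h i)) - f (u (h i)))) < e"
    proof (rule d)
      show "disjoint_family_on (\<lambda>i. {u (h i)<..<v (h i)}) {..<card Q}"
        using Q(3) h unfolding disjoint_family_on_def bij_betw_def inj_on_def by blast
      show "(\<Sum>i<card Q. v (h i) - u (h i)) < d"
        using sum.reindex_bij_betw[OF h, of "\<lambda>i. v i - u i"] Q(4) by simp
    qed (use hQ Q(2) in auto)
    then show "(\<Sum>i\<in>Q. norm (f (v i) - f (u i))) < e"
      using sum.reindex_bij_betw[OF h, of "\<lambda>i. norm (f (v i) - f (u i))"] by simp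
  qed
qed

lemma abs_continuous_on_subset:
  assumes "abs_continuous_on S f" "T \<subseteq> S"
  shows "abs_continuous_on T f"
  unfolding abs_continuous_on_def
proof (intro allI impI)
  fix e :: real assume "e > 0"
  then obtain d where "d > 0" and d: "\<forall>(m::nat) a b.
      (\<forall>i<m. a i \<le> b i \<and> {a i..b i} \<subseteq> S) \<and>
      disjoint_family_on (\<lambda>i. {a i<..<b i}) {..<m} \<and> (\<Sum>i<m. b i - a i) < d \<longrightarrow>
      (\<Sum>i<m. norm (f (b i) - f (a i))) < e"
    using assms(1) unfolding abs_continuous_on_def by blast
  show "\<exists>d>0. \<forall>(m::nat) a b.
      (\<forall>i<m. a i \<le> b i \<and> {a i..b i} \<subseteq> T) \<and>
      disjoint_family_on (\<lambda>i. {a i<..<b i}) {..<m} \<and> (\<Sum>i<m. b i - a i) < d \<longrightarrow>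
      (\<Sum>i<m. norm (f (b i) - f (a i))) < e"
    using \<open>d > 0\<close> d order_trans[OF _ assms(2)] by (intro exI[of _ d]) blast
qed

text \<open>Only increments between points of \<open>S\<close> matter: the initial value in the
  integral equation drops out, and the equation is used on the interval alone.\<close>

lemma abs_continuous_on_cong_diff:
  assumes "abs_continuous_on S g"
    and eq: "\<And>s t. s \<in> S \<Longrightarrow> t \<in> S \<Longrightarrow> f t - f s = g t - g s"
  shows "abs_continuous_on S f"
  unfolding abs_continuous_on_def
proof (intro allI impI)
  fix e :: real assume "e > 0"
  then obtain d where "d > 0" and d: "\<forall>(m::nat) a b.
      (\<forall>i<m. a i \<le> b i \<and> {a i..b i} \<subseteq> S) \<and>
      disjoint_family_on (\<lambda>i. {a i<..<b i}) {..<m} \<and> (\<Sum>i<m. b i - a i) < d \<longrightarrow>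
      (\<Sum>i<m. norm (g (b i) - g (a i))) < e"
    using assms(1) unfolding abs_continuous_on_def by blast
  show "\<exists>d>0. \<forall>(m::nat) a b.
      (\<forall>i<m. a i \<le> b i \<and> {a i..b i} \<subseteq> S) \<and>
      disjoint_family_on (\<lambda>i. {a i<..<b i}) {..<m} \<and> (\<Sum>i<m. b i - a i) < d \<longrightarrow>
      (\<Sum>i<m. norm (f (b i) - f (a i))) < e"
  proof (intro exI[of _ d] conjI allI impI \<open>d > 0\<close>)
    fix m :: nat and a b :: "nat \<Rightarrow> real"
    assume ab: "(\<forall>i<m. a i \<le> b i \<and> {a i..b i} \<subseteq> S) \<and>
      disjoint_family_on (\<lambda>i. {a i<..<b i}) {..<m} \<and> (\<Sum>i<m. b i - a i) < d"
    have "(\<Sum>i<m. norm (f (b i) - f (a i))) = (\<Sum>i<m. norm (g (b i) - g (a i)))"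
    proof (intro sum.cong refl)
      fix i assume "i \<in> {..<m}"
      then have "a i \<in> S" "b i \<in> S" using ab by fastforce+
      then show "norm (f (b i) - f (a i)) = norm (g (b i) - g (a i))" by (simp add: eq)
    qed
    also have "\<dots> < e" using d ab by blast
    finally show "(\<Sum>i<m. norm (f (b i) - f (a i))) < e" .
  qed
qed

lemma abs_continuous_on_imp_continuous_on:
  fixes f :: "real \<Rightarrow> 'a::real_normed_vector"
  assumes "abs_continuous_on {a..b} f"
  shows "continuous_on {a..b} f"
  unfolding continuous_on_iff
proof (intro ballI allI impI)
  fix x e :: real assume x: "x \<in> {a..b}" and "e > 0"
  \<comment> \<open>A single interval is a family indexed by the one-element type
    \<open>unit\<close>.\<close>
  obtain d where "d > 0" and d: "\<forall>(Q :: unit set) u v. finite Q \<and>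
      (\<forall>i\<in>Q. u i \<le> v i \<and> {u i..v i} \<subseteq> {a..b}) \<and>
      disjoint_family_on (\<lambda>i. {u i<..<v i}) Q \<and> (\<Sum>i\<in>Q. v i - u i) < d \<longrightarrow>
      (\<Sum>i\<in>Q. norm (f (v i) - f (u i))) < e"
      using abs_continuous_onD[OF assms \<open>e > 0\<close>, where 'i = unit] by blast
  have *: "norm (f t - f s) < e" if "s \<in> {a..b}" "t \<in> {a..b}" "s \<le> t" "t - s < d" for s t
    using d[rule_format, of "{()}" "\<lambda>_. s" "\<lambda>_. t"] that by (auto simp: disjoint_family_on_def)
  show "\<exists>d>0. \<forall>x'\<in>{a..b}. dist x' x < d \<longrightarrow> dist (f x') (f x) < e"
  proof (intro exI[of _ d] conjI ballI impI)
    fix x' assume x': "x' \<in> {a..b}" "dist x' x < d"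
    then show "dist (f x') (f x) < e"
      using *[of x x'] *[of x' x] x
      by (cases "x \<le> x'") (auto simp: dist_norm norm_minus_commute)
  qed fact
qed

section \<open>The fundamental theorem of calculus for absolutely continuous functions\<close>

lemma sum_length_disjoint_le:
  fixes u v :: "'i \<Rightarrow> real"
  assumes "finite Q" "\<And>i. i \<in> Q \<Longrightarrow> u i \<le> v i \<and> {u i<..<v i} \<subseteq> T"
    "disjoint_family_on (\<lambda>i. {u i<..<v i}) Q" "T \<in> lmeasurable"
  shows "(\<Sum>i\<in>Q. v i - u i) \<le> measure lebesgue T"
proof -
  have "(\<Sum>i\<in>Q. v i - u i) = (\<Sum>i\<in>Q. measure lebesgue {u i<..<v i})"
    using assms(2) by (intro sum.cong) auto
  also have "\<dots> = measure lebesgue (\<Union>i\<in>Q. {u i<..<v i})"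
  proof (rule measure_finite_Union[symmetric])
    show "emeasure lebesgue {u i<..<v i} \<noteq> \<infinity>" if "i \<in> Q" for i
      using assms(2)[OF that] by simp
  qed (use assms in auto)
  also have "\<dots> \<le> measure lebesgue T"
    using assms by (intro measure_mono_fmeasurable) auto
  finally show ?thesis .
qed

text \<open>Works directly with the gauge definition of the integral, so integrability of
  \<open>g\<close> comes out with the value. The gauge separates two kinds of tags: near the
  exceptional null set the increments of \<open>f\<close> are small by absolute continuity,
  elsewhere the derivative controls them.\<close>

lemma fundamental_theorem_of_calculus_abs_continuous:
  fixes f :: "real \<Rightarrow> 'a::euclidean_space"
  assumes "a \<le> b" and ac: "abs_continuous_on {a..b} f"
    and ae: "AE t in lebesgue_on {a..b}. (f has_vector_derivative g t) (at t within {a..b})"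
  shows "(g has_integral f b - f a) {a..b}"
proof -
  define E where "E = {t \<in> {a..b}. \<not> (f has_vector_derivative g t) (at t within {a..b})}"
  have "AE t in lebesgue. t \<in> {a..b} \<longrightarrow> (f has_vector_derivative g t) (at t within {a..b})"
    using ae by (subst (asm) AE_restrict_space_iff) auto
  then have "AE t in lebesgue. t \<notin> E" by eventually_elim (auto simp: E_def)
  then have negE: "negligible E"
    by (metis (no_types, lifting) eventually_ae_filter_negligible mem_Collect_eq negligible_subset subsetI)
  \<comment> \<open>As \<open>g'\<close> vanishes on \<open>E\<close>, a tag in \<open>E\<close>
    contributes only the increment of \<open>f\<close> to the error.\<close>
  define g' where "g' t = (if t \<in> E then 0 else g t)" for t
  have "(g' has_integral f b - f a) (cbox a b)"
    unfolding has_integral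
  proof (intro allI impI)
    fix e :: real assume "e > 0"
    then have "e / 2 > 0" by simp
    obtain d where "d > 0" and d: "\<forall>(Q :: (real \<times> real set) set) u v. finite Q \<and>
      (\<forall>i\<in>Q. u i \<le> v i \<and> {u i..v i} \<subseteq> {a..b}) \<and>
      disjoint_family_on (\<lambda>i. {u i<..<v i}) Q \<and> (\<Sum>i\<in>Q. v i - u i) < d \<longrightarrow>
      (\<Sum>i\<in>Q. norm (f (v i) - f (u i))) < e / 2"
      using abs_continuous_onD[OF ac \<open>e / 2 > 0\<close>, where 'i = "real \<times> real set"] by blast
    \<comment> \<open>The measure of \<open>T\<close> is below the \<open>d\<close> of absolute
      continuity, so disjoint intervals inside \<open>T\<close> are short enough in total.\<close>
    obtain T where T: "open T" "E \<subseteq> T" "T - E \<in> lmeasurable" "emeasure lebesgue (T - E) < ennreal d"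
      using sets_lebesgue_outer_open[OF negligible_imp_sets[OF negE] \<open>d > 0\<close>] .
    have Tm: "T \<in> lmeasurable" and Td: "measure lebesgue T < d"
    proof -
      have "T = (T - E) \<union> E" using T(2) by blast
      then show "T \<in> lmeasurable"
        using T(3) negligible_imp_measurable[OF negE] by (metis fmeasurable.Un)
      have "measure lebesgue T = measure lebesgue (T - E)"
        by (simp add: T(2,3) negE double_diff measure_negligible_symdiff)
      also have "\<dots> < d" using T(3,4) \<open>d > 0\<close>
        by (simp add: emeasure_eq_measure2 ennreal_less_iff)
      finally show "measure lebesgue T < d" .
    qed
    \<comment> \<open>Chosen so that \<open>e' * (b - a) \<le> e / 2\<close>; the added 1 covers the
      case \<open>a = b\<close>.\<close>
    define e' where "e' = e / (2 * (b - a + 1))"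
    have "e' > 0" using \<open>e > 0\<close> \<open>a \<le> b\<close> by (simp add: e'_def)
    have "\<exists>\<delta>>0. \<forall>y\<in>{a..b}. \<bar>y - t\<bar> < \<delta> \<longrightarrow> norm (f y - f t - (y - t) *\<^sub>R g t) \<le> e' * \<bar>y - t\<bar>"
      if "t \<in> {a..b} - E" for t
      using that \<open>e' > 0\<close> unfolding E_def has_vector_derivative_def has_derivative_within_alt by auto
    then obtain \<delta> where \<delta>: "\<And>t. t \<in> {a..b} - E \<Longrightarrow> \<delta> t > 0"
      "\<And>t y. t \<in> {a..b} - E \<Longrightarrow> y \<in> {a..b} \<Longrightarrow> \<bar>y - t\<bar> < \<delta> t \<Longrightarrow>
         norm (f y - f t - (y - t) *\<^sub>R g t) \<le> e' * \<bar>y - t\<bar>"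
      by metis
    \<comment> \<open>Intervals tagged in \<open>E\<close> are forced into \<open>T\<close>, all
      others into a ball where the derivative estimate holds. The value \<open>UNIV\<close> outside
      \<open>{a..b}\<close> is a dummy that makes \<open>\<Gamma>\<close> a gauge.\<close>
    define \<Gamma> where "\<Gamma> t = (if t \<in> E then T else if t \<in> {a..b} then ball t (\<delta> t) else UNIV)" for t
    have "gauge \<Gamma>" unfolding gauge_def \<Gamma>_def using T \<delta>(1) by auto
    show "\<exists>\<gamma>. gauge \<gamma> \<and> (\<forall>\<D>. \<D> tagged_division_of cbox a b \<and> \<gamma> fine \<D> \<longrightarrow>
        norm ((\<Sum>(x, K)\<in>\<D>. measure lborel K *\<^sub>R g' x) - (f b - f a)) < e)"
    proof (intro exI[of _ \<Gamma>] conjI allI impI)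
      fix \<D> assume D: "\<D> tagged_division_of cbox a b \<and> \<Gamma> fine \<D>"
      then have D1: "\<D> tagged_division_of {a..b}" and fine: "\<Gamma> fine \<D>" by auto
      have finD: "finite \<D>" using D1 by blast
      define l r where "l = (\<lambda>p :: real \<times> real set. Inf (snd p))" and "r = (\<lambda>p :: real \<times> real set. Sup (snd p))"
      have K: "snd p = {l p..r p} \<and> l p \<le> fst p \<and> fst p \<le> r p \<and> {l p..r p} \<subseteq> {a..b}
          \<and> {l p..r p} \<subseteq> \<Gamma> (fst p) \<and> measure lborel (snd p) = r p - l p" if pD: "p \<in> \<D>" for p
      proof -
        obtain x K where p: "p = (x, K)" by fastforce
        obtain c d where cd: "K = {c..d}"
          using tagged_division_ofD(4)[OF D1, of x K] pD p by auto
        have x: "x \<in> K" "K \<subseteq> {a..b}" using tagged_division_ofD(2,3)[OF D1] pD p by auto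
        then have "c \<le> d" using cd by auto
        then show ?thesis using x cd fine pD p unfolding fine_def l_def r_def by auto
      qed
      have Kc: "measure lborel (snd p) = r p - l p" if "p \<in> \<D>" for p
        using K[OF that] by blast
      define A where "A = {p \<in> \<D>. fst p \<in> E}"
      have split: "(\<Sum>p\<in>\<D>. h p) = (\<Sum>p\<in>A. h p) + (\<Sum>p\<in>\<D> - A. h p)" for h :: "_ \<Rightarrow> real"
        using sum.subset_diff[of A \<D> h] finD by (auto simp: A_def add.commute)
      have tel: "(\<Sum>p\<in>\<D>. f (r p) - f (l p)) = f b - f a"
        using additive_tagged_division_1[OF \<open>a \<le> b\<close> D1, of f]
        by (simp add: l_def r_def case_prod_beta)
      have "(\<Sum>(x, K)\<in>\<D>. measure lborel K *\<^sub>R g' x) - (f b - f a)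
          = (\<Sum>p\<in>\<D>. (r p - l p) *\<^sub>R g' (fst p) - (f (r p) - f (l p)))"
        unfolding tel[symmetric] sum_subtractf[symmetric] case_prod_beta
        using Kc by simp
      also have "norm \<dots> \<le> (\<Sum>p\<in>\<D>. norm ((r p - l p) *\<^sub>R g' (fst p) - (f (r p) - f (l p))))"
        by (rule norm_sum)
      also have "\<dots> = (\<Sum>p\<in>A. norm ((r p - l p) *\<^sub>R g' (fst p) - (f (r p) - f (l p)))) +
          (\<Sum>p\<in>\<D> - A. norm ((r p - l p) *\<^sub>R g' (fst p) - (f (r p) - f (l p))))"
        by (rule split)
      also have "(\<Sum>p\<in>A. norm ((r p - l p) *\<^sub>R g' (fst p) - (f (r p) - f (l p))))
          = (\<Sum>p\<in>A. norm (f (r p) - f (l p)))"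
        by (intro sum.cong) (auto simp: A_def g'_def norm_minus_commute)
      also have "\<dots> < e / 2"
      proof (rule d[rule_format], intro conjI ballI)
        show "finite A" using finD by (simp add: A_def)
        show "l p \<le> r p" "{l p..r p} \<subseteq> {a..b}" if "p \<in> A" for p
          using K[of p] that by (auto simp: A_def)
        show dis: "disjoint_family_on (\<lambda>i. {l i<..<r i}) A"
          unfolding disjoint_family_on_def
        proof (intro ballI impI)
          fix p q assume pq: "p \<in> A" "q \<in> A" "p \<noteq> q"
          then have "interior (snd p) \<inter> interior (snd q) = {}"
            using tagged_division_ofD(5)[OF D1, of "fst p" "snd p" "fst q" "snd q"]
            by (auto simp: A_def prod_eq_iff)
          then show "{l p<..<r p} \<inter> {l q<..<r q} = {}"
            using K[of p] K[of q] pq by (auto simp: A_def)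
        qed
        have "(\<Sum>p\<in>A. r p - l p) \<le> measure lebesgue T"
        proof (rule sum_length_disjoint_le[OF \<open>finite A\<close> _ dis Tm])
          fix p assume p: "p \<in> A"
          then have "{l p..r p} \<subseteq> T" using K[of p] by (auto simp: A_def \<Gamma>_def)
          then show "l p \<le> r p \<and> {l p<..<r p} \<subseteq> T" using K[of p] p by (force simp: A_def)
        qed
        then show "(\<Sum>p\<in>A. r p - l p) < d" using Td by simp
      qed
      also have "(\<Sum>p\<in>\<D> - A. norm ((r p - l p) *\<^sub>R g' (fst p) - (f (r p) - f (l p))))
          \<le> (\<Sum>p\<in>\<D> - A. e' * measure lborel (snd p))"
      proof (rule sum_mono)
        fix p assume p: "p \<in> \<D> - A"
        define t where "t = fst p"
        have t: "t \<in> {a..b} - E" "l p \<le> t" "t \<le> r p" and sub: "{l p..r p} \<subseteq> {a..b}"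
          using K[of p] p by (auto simp: A_def t_def)
        then have "{l p..r p} \<subseteq> ball t (\<delta> t)"
          using K[of p] p by (auto simp: A_def \<Gamma>_def t_def)
        moreover have "l p \<in> {l p..r p}" "r p \<in> {l p..r p}" using t by auto
        ultimately have "l p \<in> ball t (\<delta> t)" "r p \<in> ball t (\<delta> t)" by blast+
        then have "\<bar>l p - t\<bar> < \<delta> t" "\<bar>r p - t\<bar> < \<delta> t"
          by (simp_all add: dist_real_def abs_minus_commute)
        then have lr: "norm (f (r p) - f t - (r p - t) *\<^sub>R g t) \<le> e' * \<bar>r p - t\<bar>"
          "norm (f (l p) - f t - (l p - t) *\<^sub>R g t) \<le> e' * \<bar>l p - t\<bar>"
          using \<delta>(2)[OF t(1), of "r p"] \<delta>(2)[OF t(1), of "l p"] sub t by auto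
        \<comment> \<open>Both endpoints are compared with the tag, which lies between them, so the
          two distances add up to the length.\<close>
        have "(r p - l p) *\<^sub>R g' t - (f (r p) - f (l p)) =
            (f (l p) - f t - (l p - t) *\<^sub>R g t) - (f (r p) - f t - (r p - t) *\<^sub>R g t)"
          using t by (simp add: g'_def algebra_simps)
        also have "norm \<dots> \<le> e' * \<bar>l p - t\<bar> + e' * \<bar>r p - t\<bar>"
          using norm_triangle_ineq4 lr by (smt (verit))
        also have "\<dots> = e' * measure lborel (snd p)" using t K[of p] p by (simp add: algebra_simps)
        finally show "norm ((r p - l p) *\<^sub>R g' (fst p) - (f (r p) - f (l p))) \<le> e' * measure lborel (snd p)"
          by (simp add: t_def)
      qed
      also have "\<dots> \<le> (\<Sum>p\<in>\<D>. e' * measure lborel (snd p))"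
        using finD \<open>e' > 0\<close> by (intro sum_mono2) auto
      also have "\<dots> = e' * (b - a)"
        using additive_content_tagged_division[of \<D> a b] D \<open>a \<le> b\<close>
        by (simp add: sum_distrib_left[symmetric] case_prod_beta)
      also have "\<dots> \<le> e / 2" using \<open>e > 0\<close> \<open>a \<le> b\<close> by (simp add: e'_def field_simps)
      finally show "norm ((\<Sum>(x, K)\<in>\<D>. measure lborel K *\<^sub>R g' x) - (f b - f a)) < e" by simp
    qed fact
  qed
  then show ?thesis
    using has_integral_spike[OF negE, of "{a..b}" g g' "f b - f a"] by (simp add: g'_def)
qed


lemma has_vector_derivative_indefinite_integral_AE:
  fixes f :: "real \<Rightarrow> 'a::euclidean_space"
  assumes "f integrable_on {a..b}"
  shows "AE t in lebesgue_on {a..b}.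
    ((\<lambda>t. integral {a..t} f) has_vector_derivative f t) (at t within {a..b})"
proof -
  \<comment> \<open>The extension by zero is integrable on every interval, so averages over
    \<open>{x..x + h}\<close> may reach beyond \<open>b\<close>.\<close>
  define f0 where "f0 = (\<lambda>t. if t \<in> {a..b} then f t else 0)"
  have "f0 integrable_on UNIV"
    unfolding f0_def integrable_restrict_UNIV by (rule assms)
  then have int: "f0 integrable_on {c..d}" for c d
    using integrable_on_subinterval[of f0 UNIV c d] by (simp add: cbox_interval)
  obtain N1 where N1: "negligible N1" "\<And>x e. x \<notin> N1 \<Longrightarrow> 0 < e \<Longrightarrow>
      \<exists>d>0. \<forall>h. 0 < h \<and> h < d \<longrightarrow> norm (integral {x..x + h} f0 /\<^sub>R h - f0 x) < e"
    using integrable_ccontinuous_explicit[of f0] int by (auto simp: cbox_interval)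
  \<comment> \<open>The averages over \<open>{x..x + h}\<close> see only the right of
    \<open>x\<close>; those of the reflected function give the derivative from the left, with a
    reflected exceptional set.\<close>
  have "(\<lambda>x. f0 (- x)) integrable_on {c..d}" for c d
    using int[of "- d" "- c"] Henstock_Kurzweil_Integration.integrable_reflect_real[of f0 "- c" "- d"] by simp
  then obtain N2 where N2: "negligible N2" "\<And>x e. x \<notin> N2 \<Longrightarrow> 0 < e \<Longrightarrow>
      \<exists>d>0. \<forall>h. 0 < h \<and> h < d \<longrightarrow> norm (integral {x..x + h} (\<lambda>x. f0 (- x)) /\<^sub>R h - f0 (- x)) < e"
    using integrable_ccontinuous_explicit[of "\<lambda>x. f0 (- x)"] by (auto simp: cbox_interval)
  have incr: "integral {a..y} f - integral {a..x} f = integral {x..y} f0"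
    if "a \<le> x" "x \<le> y" "y \<le> b" for x y
  proof -
    have "integral {a..x} f0 + integral {x..y} f0 = integral {a..y} f0"
      using that int by (intro Henstock_Kurzweil_Integration.integral_combine) auto
    moreover have "integral {a..x} f0 = integral {a..x} f" "integral {a..y} f0 = integral {a..y} f"
      using that by (auto intro!: integral_cong simp: f0_def)
    ultimately show ?thesis by (metis add_diff_cancel_left')
  qed
  have scale: "norm (w - h *\<^sub>R z) \<le> e * h" if "norm (w /\<^sub>R h - z) < e" "h > 0" for w z :: 'a and e h :: real
  proof -
    have "w - h *\<^sub>R z = h *\<^sub>R (w /\<^sub>R h - z)" using that by (simp add: algebra_simps)
    then have "norm (w - h *\<^sub>R z) = h * norm (w /\<^sub>R h - z)" using that by simp
    also have "\<dots> \<le> h * e" using that by (intro mult_left_mono) auto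
    finally show ?thesis by (simp add: mult.commute)
  qed
  have der: "((\<lambda>t. integral {a..t} f) has_vector_derivative f t) (at t within {a..b})"
    if t: "t \<in> {a..b}" "t \<notin> N1" "- t \<notin> N2" for t
    unfolding has_vector_derivative_def has_derivative_within_alt
  proof (intro conjI allI impI bounded_linear_scaleR_left)
    fix e :: real assume "e > 0"
    obtain d1 where d1: "d1 > 0" "\<And>h. 0 < h \<Longrightarrow> h < d1 \<Longrightarrow> norm (integral {t..t + h} f0 /\<^sub>R h - f0 t) < e"
      using N1(2)[OF t(2) \<open>e > 0\<close>] by blast
    obtain d2 where d2: "d2 > 0" "\<And>h. 0 < h \<Longrightarrow> h < d2 \<Longrightarrow>
        norm (integral {- t..- t + h} (\<lambda>x. f0 (- x)) /\<^sub>R h - f0 t) < e"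
      using N2(2)[OF t(3) \<open>e > 0\<close>] by auto
    show "\<exists>d>0. \<forall>y\<in>{a..b}. norm (y - t) < d \<longrightarrow>
        norm (integral {a..y} f - integral {a..t} f - (y - t) *\<^sub>R f t) \<le> e * norm (y - t)"
    proof (intro exI[of _ "min d1 d2"] conjI ballI impI)
      fix y assume y: "y \<in> {a..b}" "norm (y - t) < min d1 d2"
      consider "y = t" | "y > t" | "y < t" by linarith
      then show "norm (integral {a..y} f - integral {a..t} f - (y - t) *\<^sub>R f t) \<le> e * norm (y - t)"
      proof cases
        case 2
        then have "norm (integral {t..y} f0 - (y - t) *\<^sub>R f0 t) \<le> e * (y - t)"
          using scale[OF d1(2)[of "y - t"]] y by simp
        then show ?thesis using 2 incr[of t y] t y by (simp add: f0_def)
      next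
        case 3
        have "integral {- t..- y} (\<lambda>x. f0 (- x)) = integral {y..t} f0"
          by (rule Henstock_Kurzweil_Integration.integral_reflect_real)
        then have "norm (integral {y..t} f0 - (t - y) *\<^sub>R f0 t) \<le> e * (t - y)"
          using scale[OF d2(2)[of "t - y"]] y 3 by simp
        moreover have "integral {a..y} f - integral {a..t} f - (y - t) *\<^sub>R f t =
            - (integral {y..t} f0 - (t - y) *\<^sub>R f0 t)"
          using 3 incr[of y t] t y by (simp add: f0_def algebra_simps)
        ultimately show ?thesis using 3 by (simp only: norm_minus_cancel) simp
      qed simp
    qed (use d1 d2 in simp)
  qed
  have "negligible (uminus ` N2)"
    using N2(1) by (intro negligible_differentiable_image_negligible)
      (auto intro!: differentiable_on_minus differentiable_on_id simp: id_def[symmetric])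
  then have "negligible (N1 \<union> uminus ` N2)" using N1(1) by (rule negligible_Un[rotated])
  then have "AE t in lebesgue. t \<notin> N1 \<union> uminus ` N2"
    by (intro AE_not_in) (simp only: negligible_iff_null_sets)
  then have "AE t in lebesgue. t \<in> {a..b} \<longrightarrow>
      ((\<lambda>t. integral {a..t} f) has_vector_derivative f t) (at t within {a..b})"
    by eventually_elim (use der in force)
  then show ?thesis by (subst AE_restrict_space_iff) auto
qed

text \<open>Square-integrability yields an explicit modulus: since
  \<open>norm (f t) \<le> k + (norm (f t))\<^sup>2 / k\<close>, disjoint intervals contribute at
  most \<open>k\<close> times their total length plus \<open>W / k\<close>.\<close>

lemma abs_continuous_on_indefinite_integral:
  fixes f :: "real \<Rightarrow> 'a::euclidean_space"
  assumes f: "f integrable_on {a..b}" and q: "(\<lambda>t. (norm (f t))\<^sup>2) integrable_on {a..b}"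
  shows "abs_continuous_on {a..b} (\<lambda>t. integral {a..t} f)"
  unfolding abs_continuous_on_def
proof (intro allI impI)
  fix e :: real assume "e > 0"
  define W where "W = integral {a..b} (\<lambda>t. (norm (f t))\<^sup>2)"
  have "W \<ge> 0" unfolding W_def by (intro Henstock_Kurzweil_Integration.integral_nonneg q) simp
  \<comment> \<open>\<open>W / k\<close> takes one half of \<open>e\<close>, a total length below
    \<open>e / (2 * k)\<close> the other. \<open>W + 1\<close> keeps \<open>k\<close> positive when
    \<open>W = 0\<close> and the first inequality strict.\<close>
  define k where "k = 2 * (W + 1) / e"
  have "k > 0" using \<open>W \<ge> 0\<close> \<open>e > 0\<close> by (simp add: k_def)
  have Wk: "W / k < e / 2" using \<open>W \<ge> 0\<close> \<open>e > 0\<close> by (simp add: k_def field_simps)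
  show "\<exists>d>0. \<forall>(m::nat) u v. (\<forall>i<m. u i \<le> v i \<and> {u i..v i} \<subseteq> {a..b}) \<and>
      disjoint_family_on (\<lambda>i. {u i<..<v i}) {..<m} \<and> (\<Sum>i<m. v i - u i) < d \<longrightarrow>
      (\<Sum>i<m. norm (integral {a..v i} f - integral {a..u i} f)) < e"
  proof (intro exI[of _ "e / (2 * k)"] conjI allI impI)
    fix m :: nat and u v :: "nat \<Rightarrow> real"
    assume "(\<forall>i<m. u i \<le> v i \<and> {u i..v i} \<subseteq> {a..b}) \<and>
      disjoint_family_on (\<lambda>i. {u i<..<v i}) {..<m} \<and> (\<Sum>i<m. v i - u i) < e / (2 * k)"
    then have uv: "\<And>i. i < m \<Longrightarrow> u i \<le> v i" "\<And>i. i < m \<Longrightarrow> {u i..v i} \<subseteq> {a..b}"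
      and dis: "disjoint_family_on (\<lambda>i. {u i<..<v i}) {..<m}"
      and len: "(\<Sum>i<m. v i - u i) < e / (2 * k)" by blast+
    have ab: "a \<le> u i" "v i \<le> b" if "i < m" for i using uv[OF that] by auto
    have qi: "(\<lambda>t. (norm (f t))\<^sup>2) integrable_on {u i..v i}" "f integrable_on {u i..v i}" if "i < m" for i
      using q f uv(2)[OF that] by (auto intro: integrable_subinterval_real)
    have le: "norm (integral {a..v i} f - integral {a..u i} f) \<le>
        k * (v i - u i) + integral {u i..v i} (\<lambda>t. (norm (f t))\<^sup>2) / k" if "i < m" for i
    proof -
      have "integral {a..u i} f + integral {u i..v i} f = integral {a..v i} f"
        using that uv ab by (intro Henstock_Kurzweil_Integration.integral_combine integrable_subinterval_real[OF f]) auto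
      then have "norm (integral {a..v i} f - integral {a..u i} f) = norm (integral {u i..v i} f)"
        by (metis add_diff_cancel_left')
      also have "\<dots> \<le> integral {u i..v i} (\<lambda>t. k + (norm (f t))\<^sup>2 / k)"
      proof (rule integral_norm_bound_integral)
        show "(\<lambda>t. k + (norm (f t))\<^sup>2 / k) integrable_on {u i..v i}"
          using qi(1)[OF that] by (intro integrable_add integrable_on_divide) auto
        show "norm (f t) \<le> k + (norm (f t))\<^sup>2 / k" for t
        proof (cases "norm (f t) \<le> k")
          case False
          then have "norm (f t) * k \<le> (norm (f t))\<^sup>2"
            by (simp add: power2_eq_square mult_left_mono)
          then show ?thesis using \<open>k > 0\<close> by (simp add: field_simps add_increasing)
        qed (use \<open>k > 0\<close> in \<open>simp add: add_increasing2\<close>)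
      qed (use qi that in simp)
      also have "\<dots> = k * (v i - u i) + integral {u i..v i} (\<lambda>t. (norm (f t))\<^sup>2) / k"
        using qi(1)[OF that] uv(1)[OF that]
        by (subst Henstock_Kurzweil_Integration.integral_add) (auto intro: integrable_on_divide)
      finally show ?thesis .
    qed
    have "(\<Sum>i<m. integral {u i..v i} (\<lambda>t. (norm (f t))\<^sup>2)) \<le> W"
    proof -
      have "((\<lambda>t. (norm (f t))\<^sup>2) has_integral (\<Sum>i<m. integral {u i..v i} (\<lambda>t. (norm (f t))\<^sup>2)))
          (\<Union>i<m. {u i<..<v i})"
      proof (rule has_integral_UN)
        show "((\<lambda>t. (norm (f t))\<^sup>2) has_integral integral {u i..v i} (\<lambda>t. (norm (f t))\<^sup>2)) {u i<..<v i}"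
          if "i \<in> {..<m}" for i
          using qi(1) that by (simp add: has_integral_Icc_iff_Ioo[symmetric] integrable_integral)
        show "pairwise (\<lambda>i i'. negligible ({u i<..<v i} \<inter> {u i'<..<v i'})) {..<m}"
          using dis by (auto simp: pairwise_def disjoint_family_on_def)
      qed simp
      moreover have "(\<Union>i<m. {u i<..<v i}) \<subseteq> {a..b}" using uv by fastforce
      ultimately show ?thesis unfolding W_def
        using has_integral_subset_le[OF _ _ integrable_integral[OF q]] by fastforce
    qed
    then have "(\<Sum>i<m. integral {u i..v i} (\<lambda>t. (norm (f t))\<^sup>2)) / k \<le> W / k"
      using \<open>k > 0\<close> by (simp add: divide_right_mono)
    moreover have "k * (\<Sum>i<m. v i - u i) < e / 2"
      using len \<open>k > 0\<close> by (simp add: field_simps)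
    moreover have "(\<Sum>i<m. norm (integral {a..v i} f - integral {a..u i} f)) \<le>
        k * (\<Sum>i<m. v i - u i) + (\<Sum>i<m. integral {u i..v i} (\<lambda>t. (norm (f t))\<^sup>2)) / k"
      using sum_mono[of "{..<m}", OF le] by (simp add: sum.distrib sum_distrib_left sum_divide_distrib)
    ultimately show "(\<Sum>i<m. norm (integral {a..v i} f - integral {a..u i} f)) < e"
      using Wk by linarith
  qed (use \<open>e > 0\<close> \<open>k > 0\<close> in simp)
qed

section \<open>Square-integrable functions and Gronwall's inequality\<close>

lemma continuous_on_imp_measurable_unit_interval:
  fixes f :: "real \<Rightarrow> 'a::euclidean_space"
  assumes "continuous_on {0..1} f"
  shows "f \<in> borel_measurable (lebesgue_on {0..1})"
  using assms by (intro continuous_imp_measurable_on_sets_lebesgue) auto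

lemma sq_integrable_scaleR_bounded:
  fixes g :: "real \<Rightarrow> 'a::euclidean_space"
  assumes c: "sq_integrable c" and g: "g \<in> borel_measurable (lebesgue_on {0..1})"
    and B: "\<And>t. t \<in> {0..1} \<Longrightarrow> norm (g t) \<le> B"
  shows "sq_integrable (\<lambda>t. c t *\<^sub>R g t)"
  unfolding sq_integrable_def
proof
  have cm: "c \<in> borel_measurable (lebesgue_on {0..1})"
    and ci: "integrable (lebesgue_on {0..1}) (\<lambda>t. (norm (c t))\<^sup>2)"
    using c by (auto simp: sq_integrable_def)
  show m: "(\<lambda>t. c t *\<^sub>R g t) \<in> borel_measurable (lebesgue_on {0..1})"
    using cm g by (rule borel_measurable_scaleR)
  show "integrable (lebesgue_on {0..1}) (\<lambda>t. (norm (c t *\<^sub>R g t))\<^sup>2)"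
  proof (rule Bochner_Integration.integrable_bound)
    show "integrable (lebesgue_on {0..1}) (\<lambda>t. B\<^sup>2 * (norm (c t))\<^sup>2)" using ci by simp
    show "(\<lambda>t. (norm (c t *\<^sub>R g t))\<^sup>2) \<in> borel_measurable (lebesgue_on {0..1})"
      using m by measurable
    have "norm ((norm (c t *\<^sub>R g t))\<^sup>2) \<le> norm (B\<^sup>2 * (norm (c t))\<^sup>2)" if "t \<in> {0..1}" for t
      using power_mono[OF B[OF that], of 2] by (simp add: power_mult_distrib mult.commute[of "B\<^sup>2"] mult_left_mono)
    then show "AE t in lebesgue_on {0..1}. norm ((norm (c t *\<^sub>R g t))\<^sup>2) \<le> norm (B\<^sup>2 * (norm (c t))\<^sup>2)"
      by (intro AE_I2) simp
  qed
qed

lemma sq_integrable_sum: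
  assumes "finite A" "\<And>i. i \<in> A \<Longrightarrow> sq_integrable (f i)"
  shows "sq_integrable (\<lambda>t. \<Sum>i\<in>A. f i t)"
  using assms by (induction rule: finite_induct) (auto simp: sq_integrable_simps)

lemma sq_integrable_bounded:
  fixes g :: "real \<Rightarrow> 'a::euclidean_space"
  assumes "g \<in> borel_measurable (lebesgue_on {0..1})" "\<And>t. t \<in> {0..1} \<Longrightarrow> norm (g t) \<le> B"
  shows "sq_integrable g"
proof -
  have "sq_integrable (\<lambda>_. 1 :: real)" by (simp add: sq_integrable_def)
  from sq_integrable_scaleR_bounded[OF this assms] show ?thesis by simp
qed

lemma continuous_on_unit_interval_bounded:
  fixes g :: "real \<Rightarrow> 'a::real_normed_vector"
  assumes "continuous_on {0..1} g"
  shows "\<exists>B. \<forall>t\<in>{0..1}. norm (g t) \<le> B"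
  using compact_imp_bounded[OF compact_continuous_image[OF assms compact_Icc]]
  by (auto simp: bounded_iff)

lemma sq_integrable_continuous:
  fixes g :: "real \<Rightarrow> 'a::euclidean_space"
  assumes "continuous_on {0..1} g"
  shows "sq_integrable g"
proof -
  obtain B where "\<forall>t\<in>{0..1}. norm (g t) \<le> B"
    using continuous_on_unit_interval_bounded[OF assms] ..
  then show ?thesis
    by (intro sq_integrable_bounded[of g B] continuous_on_imp_measurable_unit_interval[OF assms]) auto
qed

lemma sq_integrable_indicator:
  fixes g :: "real \<Rightarrow> 'a::euclidean_space"
  assumes "sq_integrable g"
  shows "sq_integrable (\<lambda>s. indicator {0..t} s *\<^sub>R g s)"
proof -
  have gm: "g \<in> borel_measurable (lebesgue_on {0..1})"
    and gi: "integrable (lebesgue_on {0..1}) (\<lambda>t. (norm (g t))\<^sup>2)"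
    using assms by (auto simp: sq_integrable_def)
  have im: "indicator {0..t} \<in> borel_measurable (lebesgue_on {0..1::real})"
    by (intro measurable_restrict_space1 borel_measurable_indicator) simp
  have m: "(\<lambda>s. indicator {0..t} s *\<^sub>R g s) \<in> borel_measurable (lebesgue_on {0..1})"
    by (intro borel_measurable_scaleR im gm)
  moreover have "integrable (lebesgue_on {0..1}) (\<lambda>s. (norm (indicator {0..t} s *\<^sub>R g s))\<^sup>2)"
  proof (rule Bochner_Integration.integrable_bound[OF gi])
    show "(\<lambda>s. (norm (indicator {0..t} s *\<^sub>R g s))\<^sup>2) \<in> borel_measurable (lebesgue_on {0..1})"
      using m by measurable
  qed (auto simp: indicator_def)
  ultimately show ?thesis by (simp add: sq_integrable_def)
qed

lemma sq_integrable_norm: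
  assumes "sq_integrable f" shows "sq_integrable (\<lambda>t. norm (f t))"
  using assms by (auto simp: sq_integrable_def intro: borel_measurable_norm)

lemma sq_integrable_component:
  fixes u :: "real \<Rightarrow> real ^ 'k"
  assumes "sq_integrable u" shows "sq_integrable (\<lambda>t. u t $ i)"
proof -
  have um: "u \<in> borel_measurable (lebesgue_on {0..1})"
    and ui: "integrable (lebesgue_on {0..1}) (\<lambda>t. (norm (u t))\<^sup>2)"
    using assms by (auto simp: sq_integrable_def)
  have eq: "u t $ i = u t \<bullet> axis i 1" for t by (simp add: inner_axis)
  have m: "(\<lambda>t. u t $ i) \<in> borel_measurable (lebesgue_on {0..1})"
    unfolding eq using um by (intro borel_measurable_inner) auto
  moreover have "integrable (lebesgue_on {0..1}) (\<lambda>t. (norm (u t $ i))\<^sup>2)"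
  proof (rule Bochner_Integration.integrable_bound[OF ui])
    show "(\<lambda>t. (norm (u t $ i))\<^sup>2) \<in> borel_measurable (lebesgue_on {0..1})"
      using m by measurable
    have "norm ((norm (u t $ i))\<^sup>2) \<le> norm ((norm (u t))\<^sup>2)" for t
      using power_mono[OF component_le_norm_cart[of "u t" i], of 2] by simp
    then show "AE t in lebesgue_on {0..1}. norm ((norm (u t $ i))\<^sup>2) \<le> norm ((norm (u t))\<^sup>2)"
      by simp
  qed
  ultimately show ?thesis by (simp add: sq_integrable_def)
qed

lemma sq_integrable_imp_integrable:
  fixes f :: "real \<Rightarrow> 'a::euclidean_space"
  assumes "sq_integrable f" shows "integrable (lebesgue_on {0..1}) f"
proof (rule Bochner_Integration.integrable_bound)
  show "integrable (lebesgue_on {0..1}) (\<lambda>t. 1 + (norm (f t))\<^sup>2)"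
    using assms by (simp add: sq_integrable_def)
  have "norm (f t) \<le> 1 + (norm (f t))\<^sup>2" for t
    using sum_squares_bound[of 1 "norm (f t)"] norm_ge_zero[of "f t"] by (simp del: norm_ge_zero)
  then show "AE t in lebesgue_on {0..1}. norm (f t) \<le> norm (1 + (norm (f t))\<^sup>2)" by simp
qed (use assms in \<open>simp add: sq_integrable_def\<close>)

lemma integrable_unit_imp_integrable_on:
  fixes f :: "real \<Rightarrow> 'a::euclidean_space"
  assumes "integrable (lebesgue_on {0..1}) f" "t \<le> 1"
  shows "f integrable_on {0..t}"
  by (rule integrable_subinterval_real[OF integrable_on_lebesgue_on[OF assms(1)]])
    (use assms(2) in auto)

lemma sq_integrable_integrable_on:
  fixes f :: "real \<Rightarrow> 'a::euclidean_space"
  assumes "sq_integrable f" "t \<le> 1"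
  shows "f integrable_on {0..t}" "(\<lambda>t. (norm (f t))\<^sup>2) integrable_on {0..t}"
proof -
  show "f integrable_on {0..t}"
    using sq_integrable_imp_integrable[OF assms(1)] assms(2) by (rule integrable_unit_imp_integrable_on)
  have "integrable (lebesgue_on {0..1}) (\<lambda>t. (norm (f t))\<^sup>2)"
    using assms(1) by (simp add: sq_integrable_def)
  then show "(\<lambda>t. (norm (f t))\<^sup>2) integrable_on {0..t}"
    using assms(2) by (rule integrable_unit_imp_integrable_on)
qed

text \<open>The bridge between the Lebesgue integral in the inner product of \<open>L2\<close> and
  the gauge integral in the integral equation.\<close>

lemma integral_indicator_unit:
  fixes f :: "real \<Rightarrow> 'a::euclidean_space"
  assumes "integrable (lebesgue_on {0..1}) (\<lambda>s. indicator {0..t} s *\<^sub>R f s)" "t \<le> 1"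
  shows "(LINT s|lebesgue_on {0..1}. indicator {0..t} s *\<^sub>R f s) = integral {0..t} f"
proof -
  have "(LINT s|lebesgue_on {0..1}. indicator {0..t} s *\<^sub>R f s) = integral {0..1} (\<lambda>s. indicator {0..t} s *\<^sub>R f s)"
    by (rule lebesgue_integral_eq_integral[OF assms(1)]) simp
  also have "\<dots> = integral {0..1} (\<lambda>s. if s \<in> {0..t} then f s else 0)"
    by (rule integral_cong) (auto simp: indicator_def)
  also have "\<dots> = integral {0..t} f"
  proof -
    have "{0..t} \<inter> {0..1} = {0..t}" using assms(2) by auto
    then show ?thesis
      using Henstock_Kurzweil_Integration.integral_restrict_Int[of "{0..1}" "{0..t}" f] by (rule subst)
  qed
  finally show ?thesis .
qed

section \<open>Elements of \<open>L2\<close> and their representatives\<close>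

lemma L2_cases:
  obtains f where "sq_integrable f" "u = abs_L2 f"
proof (rule that[of "rep_L2 u"])
  show "sq_integrable (rep_L2 u)"
    using Quotient_rep_reflp[OF Quotient_L2, of u] by (simp add: L2_rel_def)
  show "u = abs_L2 (rep_L2 u)"
    by (rule Quotient_abs_rep[OF Quotient_L2, symmetric])
qed

lemma L2_rel_refl: "sq_integrable f \<Longrightarrow> L2_rel f f"
  by (simp add: L2_rel_def)

lemma inner_abs_L2:
  assumes "sq_integrable f" "sq_integrable g"
  shows "abs_L2 f \<bullet> abs_L2 g = (LINT t|lebesgue_on {0..1}. f t \<bullet> g t)"
  using assms by (simp add: inner_L2.abs_eq L2_rel_refl)

lemma norm_abs_L2:
  assumes "sq_integrable f"
  shows "(norm (abs_L2 f))\<^sup>2 = (LINT t|lebesgue_on {0..1}. (norm (f t))\<^sup>2)"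
  using assms by (simp add: power2_norm_eq_inner inner_abs_L2)

text \<open>The inequality of the inner product space \<open>L2\<close>, applied to \<open>f\<close>
  and to \<open>g\<close> cut off at \<open>t\<close>. The factor with \<open>g\<close> keeps the
  interval \<open>{0..t}\<close>, as a Gronwall argument requires.\<close>

lemma Cauchy_Schwarz_integral_unit:
  fixes f g :: "real \<Rightarrow> real"
  assumes f: "sq_integrable f" and g: "sq_integrable g" and t: "t \<le> 1"
  shows "(integral {0..t} (\<lambda>s. f s * g s))\<^sup>2 \<le>
    (LINT s|lebesgue_on {0..1}. (f s)\<^sup>2) * integral {0..t} (\<lambda>s. (g s)\<^sup>2)"
proof -
  let ?g = "\<lambda>s. indicator {0..t} s *\<^sub>R g s"
  have g': "sq_integrable ?g" by (rule sq_integrable_indicator[OF g])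
  have "abs_L2 f \<bullet> abs_L2 ?g = (LINT s|lebesgue_on {0..1}. indicator {0..t} s *\<^sub>R (f s * g s))"
    unfolding inner_abs_L2[OF f g'] by (simp add: mult.left_commute)
  also have "\<dots> = integral {0..t} (\<lambda>s. f s * g s)"
    using sq_integrable_integrable_inner[OF f g'] t
    by (intro integral_indicator_unit) (simp_all add: mult.left_commute)
  finally have fg: "abs_L2 f \<bullet> abs_L2 ?g = integral {0..t} (\<lambda>s. f s * g s)" .
  have eq: "?g s \<bullet> ?g s = indicator {0..t} s *\<^sub>R (g s)\<^sup>2" for s
    by (simp add: indicator_def power2_eq_square)
  have "abs_L2 ?g \<bullet> abs_L2 ?g = (LINT s|lebesgue_on {0..1}. indicator {0..t} s *\<^sub>R (g s)\<^sup>2)"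
    unfolding inner_abs_L2[OF g' g'] eq ..
  also have "\<dots> = integral {0..t} (\<lambda>s. (g s)\<^sup>2)"
    using sq_integrable_integrable_inner[OF g' g'] t unfolding eq by (rule integral_indicator_unit)
  finally have gg: "abs_L2 ?g \<bullet> abs_L2 ?g = integral {0..t} (\<lambda>s. (g s)\<^sup>2)" .
  have ff: "abs_L2 f \<bullet> abs_L2 f = (LINT s|lebesgue_on {0..1}. (f s)\<^sup>2)"
    unfolding inner_abs_L2[OF f f] by (simp add: power2_eq_square)
  show ?thesis
    using Cauchy_Schwarz_ineq[of "abs_L2 f" "abs_L2 ?g"] unfolding fg gg ff .
qed

text \<open>The bound involves \<alpha> only at \<open>t\<close> and in the mean. For a sequence of
  such \<alpha>, convergence to 0 at \<open>t\<close> and of the integrals therefore suffices, with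
  no uniformity in time.\<close>

lemma Gronwall_unit_interval:
  fixes y \<alpha> :: "real \<Rightarrow> real"
  assumes y: "continuous_on {0..1} y" and \<alpha>: "continuous_on {0..1} \<alpha>"
    and \<alpha>0: "\<And>t. t \<in> {0..1} \<Longrightarrow> 0 \<le> \<alpha> t" and "B \<ge> 0"
    and le: "\<And>t. t \<in> {0..1} \<Longrightarrow> y t \<le> \<alpha> t + B * integral {0..t} y"
    and t: "t \<in> {0..1}"
  shows "y t \<le> \<alpha> t + B * exp B * integral {0..1} \<alpha>"
proof -
  \<comment> \<open>The integrating factor: the hypothesis bounds
    \<open>y s - B * integral {0..s} y\<close> by \<open>\<alpha> s\<close>, and the exponential is
    at most 1, so \<phi> decreases from its value 0.\<close>
  define \<phi> where "\<phi> s = exp (- B * s) * integral {0..s} y - integral {0..s} \<alpha>" for s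
  have der: "(\<phi> has_real_derivative
      (exp (- B * s) * (y s - B * integral {0..s} y) - \<alpha> s)) (at s within {0..1})" if "s \<in> {0..1}" for s
  proof -
    have "((\<lambda>s. exp (- B * s)) has_real_derivative exp (- B * s) * (- B)) (at s within {0..1})"
      by (auto intro!: derivative_eq_intros)
    from DERIV_diff[OF DERIV_mult[OF this integral_has_real_derivative[OF y that]]
        integral_has_real_derivative[OF \<alpha> that]]
    show ?thesis unfolding \<phi>_def by (rule DERIV_cong) (simp add: algebra_simps)
  qed
  have "\<phi> t \<le> \<phi> 0"
  proof (rule DERIV_nonpos_imp_decreasing_open[of 0 t \<phi>])
    show "\<exists>z. (\<phi> has_real_derivative z) (at s) \<and> z \<le> 0" if "0 < s" "s < t" for s
    proof (intro exI conjI)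
      have s: "s \<in> {0..1}" using that t by auto
      have "at s within {0..1} = at s" using that t by (intro at_within_Icc_at) auto
      then show "(\<phi> has_real_derivative
          (exp (- B * s) * (y s - B * integral {0..s} y) - \<alpha> s)) (at s)"
        using der[OF s] by simp
      have "exp (- B * s) * (y s - B * integral {0..s} y) \<le> exp (- B * s) * \<alpha> s"
        using le[OF s] by (intro mult_left_mono) auto
      also have "\<dots> \<le> 1 * \<alpha> s"
        using \<alpha>0[OF s] s \<open>B \<ge> 0\<close> by (intro mult_right_mono) auto
      finally show "exp (- B * s) * (y s - B * integral {0..s} y) - \<alpha> s \<le> 0" by simp
    qed
    have "continuous_on {0..1} \<phi>"
      using der by (rule DERIV_continuous_on)
    then show "continuous_on {0..t} \<phi>" by (rule continuous_on_subset) (use t in auto)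
  qed (use t in auto)
  then have "exp (- B * t) * integral {0..t} y \<le> integral {0..t} \<alpha>" by (simp add: \<phi>_def)
  then have "exp (B * t) * (exp (- B * t) * integral {0..t} y) \<le> exp (B * t) * integral {0..t} \<alpha>"
    by (intro mult_left_mono) auto
  then have "integral {0..t} y \<le> exp (B * t) * integral {0..t} \<alpha>"
    by (simp add: mult.assoc[symmetric] exp_add[symmetric])
  also have "\<dots> \<le> exp B * integral {0..1} \<alpha>"
  proof (rule mult_mono)
    show "exp (B * t) \<le> exp B" using t \<open>B \<ge> 0\<close> by (simp add: mult_left_le)
    have i1: "\<alpha> integrable_on {0..1}" using \<alpha> by (rule integrable_continuous_real)
    have sub: "{0..t} \<subseteq> {0..1}" using t by auto
    have it: "\<alpha> integrable_on {0..t}" by (rule integrable_subinterval_real[OF i1 sub])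
    show "integral {0..t} \<alpha> \<le> integral {0..1} \<alpha>"
      by (rule integral_subset_le[OF sub it i1]) (use \<alpha>0 in blast)
    show "0 \<le> integral {0..t} \<alpha>"
      by (rule Henstock_Kurzweil_Integration.integral_nonneg[OF it]) (use sub \<alpha>0 in blast)
  qed auto
  finally have "B * integral {0..t} y \<le> B * (exp B * integral {0..1} \<alpha>)"
    using \<open>B \<ge> 0\<close> by (rule mult_left_mono)
  then show ?thesis using le[OF t] by simp
qed

section \<open>The controlled flow\<close>

text \<open>Control and curve are independent arguments: the comparison argument inserts the
  difference of two controls along the trajectory of one of them.\<close>

definition control_rhs :: "('k::finite \<Rightarrow> 'a::real_normed_vector \<Rightarrow> 'a) \<Rightarrow> (real \<Rightarrow> real ^ 'k) \<Rightarrow> (real \<Rightarrow> 'a) \<Rightarrow> real \<Rightarrow> 'a" where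
  "control_rhs F u X t = (\<Sum>i\<in>UNIV. (u t $ i) *\<^sub>R F i (X t))"

lemma control_rhs_diff_left:
  "control_rhs F (\<lambda>t. u t - v t) X t = control_rhs F u X t - control_rhs F v X t"
  by (simp add: control_rhs_def scaleR_diff_left sum_subtractf)

locale lipschitz_fields =
  fixes F :: "'k::finite \<Rightarrow> 'a::euclidean_space \<Rightarrow> 'a" and L :: real
  assumes lipschitz: "\<And>i. L-lipschitz_on UNIV (F i)"
begin

text \<open>Each component of the control is estimated by its norm and the \<open>CARD('k)\<close>
  summands are added, so \<open>M * norm (u t)\<close> is a Lipschitz constant of the field at time
  \<open>t\<close>.\<close>

definition "M = real CARD('k) * L"

lemma M_nonneg: "0 \<le> M"
  using lipschitz_on_nonneg[OF lipschitz] by (simp add: M_def)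

lemma continuous_on_F_comp:
  assumes "continuous_on S X" shows "continuous_on S (\<lambda>t. F i (X t))"
  using continuous_on_compose2[OF lipschitz_on_continuous_on[OF lipschitz] assms] by simp

lemma norm_control_rhs_diff:
  "norm (control_rhs F u X t - control_rhs F u Y t) \<le> M * norm (u t) * norm (X t - Y t)"
proof -
  have "control_rhs F u X t - control_rhs F u Y t = (\<Sum>i\<in>UNIV. (u t $ i) *\<^sub>R (F i (X t) - F i (Y t)))"
    by (simp add: control_rhs_def sum_subtractf scaleR_diff_right)
  also have "norm \<dots> \<le> (\<Sum>i\<in>(UNIV :: 'k set). norm (u t) * (L * norm (X t - Y t)))"
  proof (rule sum_norm_le)
    fix i
    have "norm (F i (X t) - F i (Y t)) \<le> L * norm (X t - Y t)"
      using lipschitz_onD[OF lipschitz, of "X t" "Y t" i] by (simp add: dist_norm)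
    then show "norm ((u t $ i) *\<^sub>R (F i (X t) - F i (Y t))) \<le> norm (u t) * (L * norm (X t - Y t))"
      using component_le_norm_cart[of "u t" i] by (auto intro!: mult_mono)
  qed
  also have "\<dots> = M * norm (u t) * norm (X t - Y t)" by (simp add: M_def)
  finally show ?thesis .
qed

lemma sq_integrable_control_rhs:
  assumes "sq_integrable u" "continuous_on {0..1} X"
  shows "sq_integrable (control_rhs F u X)"
proof -
  have "sq_integrable (\<lambda>t. (u t $ i) *\<^sub>R F i (X t))" for i
  proof -
    note c = continuous_on_F_comp[OF assms(2), of i]
    obtain B where "\<forall>t\<in>{0..1}. norm (F i (X t)) \<le> B"
      using continuous_on_unit_interval_bounded[OF c] ..
    then show ?thesis
      by (intro sq_integrable_scaleR_bounded[where B = B] sq_integrable_component assms(1)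
          continuous_on_imp_measurable_unit_interval[OF c]) auto
  qed
  then show ?thesis unfolding control_rhs_def[abs_def] by (intro sq_integrable_sum) auto
qed

lemmas control_rhs_integrable_on = sq_integrable_integrable_on(1)[OF sq_integrable_control_rhs]

text \<open>From left to right this is the fundamental theorem on each \<open>{0..t}\<close>.
  Conversely, the fields are bounded along a continuous curve, so the right-hand side inherits
  square-integrability from \<open>u\<close>; its integral is then absolutely continuous and
  differentiable almost everywhere.\<close>

lemma trajectory_fun_iff_integral:
  assumes u: "sq_integrable u"
  shows "trajectory_fun F u x X \<longleftrightarrow> continuous_on {0..1} X \<and>
    (\<forall>t\<in>{0..1}. X t = x + integral {0..t} (control_rhs F u X))"
proof
  assume traj: "trajectory_fun F u x X"
  then have ac: "abs_continuous_on {0..1} X" and X0: "X 0 = x"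
    and ae: "AE t in lebesgue_on {0..1}. (X has_vector_derivative control_rhs F u X t) (at t within {0..1})"
    by (auto simp: trajectory_fun_def control_rhs_def)
  have "X t = x + integral {0..t} (control_rhs F u X)" if t: "t \<in> {0..1}" for t
  proof -
    have "abs_continuous_on {0..t} X"
      by (rule abs_continuous_on_subset[OF ac]) (use t in auto)
    moreover have "AE s in lebesgue_on {0..t}. (X has_vector_derivative control_rhs F u X s) (at s within {0..t})"
    proof -
      have "AE s in lebesgue. s \<in> {0..1} \<longrightarrow> (X has_vector_derivative control_rhs F u X s) (at s within {0..1})"
        using ae by (subst (asm) AE_restrict_space_iff) auto
      then have "AE s in lebesgue. s \<in> {0..t} \<longrightarrow> (X has_vector_derivative control_rhs F u X s) (at s within {0..t})"
      proof eventually_elim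
        case (elim s)
        have sub: "{0..t} \<subseteq> {0..1}" using t by auto
        show ?case using elim sub has_vector_derivative_within_subset[OF _ sub] by blast
      qed
      then show ?thesis by (subst AE_restrict_space_iff) auto
    qed
    ultimately have "(control_rhs F u X has_integral X t - X 0) {0..t}"
      using t by (intro fundamental_theorem_of_calculus_abs_continuous) auto
    then show ?thesis using X0 by (simp add: integral_unique)
  qed
  with abs_continuous_on_imp_continuous_on[OF ac]
  show "continuous_on {0..1} X \<and> (\<forall>t\<in>{0..1}. X t = x + integral {0..t} (control_rhs F u X))" by blast
next
  assume *: "continuous_on {0..1} X \<and> (\<forall>t\<in>{0..1}. X t = x + integral {0..t} (control_rhs F u X))"
  then have X: "\<And>t. t \<in> {0..1} \<Longrightarrow> X t = x + integral {0..t} (control_rhs F u X)" by blast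
  have sq: "sq_integrable (control_rhs F u X)" using sq_integrable_control_rhs[OF u] * by blast
  have int: "control_rhs F u X integrable_on {0..1}" "(\<lambda>t. (norm (control_rhs F u X t))\<^sup>2) integrable_on {0..1}"
    using sq_integrable_integrable_on[OF sq, of 1] by auto
  have "X 0 = x" using X[of 0] by simp
  moreover have "abs_continuous_on {0..1} X"
    by (rule abs_continuous_on_cong_diff[OF abs_continuous_on_indefinite_integral[OF int]]) (simp add: X)
  moreover have "AE t in lebesgue_on {0..1}. (X has_vector_derivative control_rhs F u X t) (at t within {0..1})"
    using has_vector_derivative_indefinite_integral_AE[OF int(1)] AE_space
  proof eventually_elim
    case (elim t)
    have t: "t \<in> {0..1}" using elim by simp
    have "((\<lambda>t. x + integral {0..t} (control_rhs F u X)) has_vector_derivative control_rhs F u X t) (at t within {0..1})"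
      using elim has_vector_derivative_add[OF has_vector_derivative_const] by fastforce
    then show ?case
      by (rule has_vector_derivative_transform[OF t, rotated]) (rule X)
  qed
  ultimately show "trajectory_fun F u x X"
    by (simp add: trajectory_fun_def control_rhs_def)
qed


section \<open>Gronwall estimates, stability and existence of trajectories\<close>

lemma sq_integrable_M_norm:
  assumes "sq_integrable u"
  shows "sq_integrable (\<lambda>t. M * norm (u t))"
  using sq_integrable_scaleR[OF sq_integrable_norm[OF assms], of M] by simp

lemma integrable_M_norm_mult:
  assumes "sq_integrable u" "continuous_on {0..1} z" "t \<le> 1"
  shows "(\<lambda>s. M * norm (u s) * z s) integrable_on {0..t}"
  using sq_integrable_integrable_inner[OF sq_integrable_M_norm[OF assms(1)] sq_integrable_continuous[OF assms(2)]]
  by (intro integrable_unit_imp_integrable_on[OF _ assms(3)]) simp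

text \<open>Cauchy-Schwarz splits off the control and leaves an integral of
  \<open>(z s)\<^sup>2\<close> with a constant factor.\<close>

lemma square_integral_M_norm_le:
  fixes z :: "real \<Rightarrow> real"
  assumes u: "sq_integrable u" and U: "(LINT t|lebesgue_on {0..1}. (norm (u t))\<^sup>2) \<le> U"
    and z: "continuous_on {0..1} z" and t: "t \<in> {0..1}"
  shows "(integral {0..t} (\<lambda>s. M * norm (u s) * z s))\<^sup>2 \<le> M\<^sup>2 * U * integral {0..t} (\<lambda>s. (z s)\<^sup>2)"
proof -
  have "(integral {0..t} (\<lambda>s. M * norm (u s) * z s))\<^sup>2 \<le>
      (LINT s|lebesgue_on {0..1}. (M * norm (u s))\<^sup>2) * integral {0..t} (\<lambda>s. (z s)\<^sup>2)"
    using t by (intro Cauchy_Schwarz_integral_unit sq_integrable_M_norm u sq_integrable_continuous z) auto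
  also have "(LINT s|lebesgue_on {0..1}. (M * norm (u s))\<^sup>2) = M\<^sup>2 * (LINT s|lebesgue_on {0..1}. (norm (u s))\<^sup>2)"
    by (simp add: power_mult_distrib)
  also have "\<dots> * integral {0..t} (\<lambda>s. (z s)\<^sup>2) \<le> M\<^sup>2 * U * integral {0..t} (\<lambda>s. (z s)\<^sup>2)"
    using sq_integrable_integrable_on(2)[OF sq_integrable_continuous[OF z], of t] t
    by (intro mult_right_mono mult_left_mono U Henstock_Kurzweil_Integration.integral_nonneg) auto
  finally show ?thesis .
qed

text \<open>Squaring turns the integrable coefficient \<open>M * norm (u s)\<close> into a constant one,
  so that the elementary Gronwall inequality suffices.\<close>

lemma Gronwall_control:
  fixes z r :: "real \<Rightarrow> real"
  assumes u: "sq_integrable u" and U: "(LINT t|lebesgue_on {0..1}. (norm (u t))\<^sup>2) \<le> U"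
    and z: "continuous_on {0..1} z" "\<And>t. t \<in> {0..1} \<Longrightarrow> 0 \<le> z t"
    and r: "continuous_on {0..1} r"
    and le: "\<And>t. t \<in> {0..1} \<Longrightarrow> z t \<le> r t + integral {0..t} (\<lambda>s. M * norm (u s) * z s)"
    and t: "t \<in> {0..1}"
  shows "(z t)\<^sup>2 \<le> 2 * (r t)\<^sup>2 + 2 * M\<^sup>2 * U * exp (2 * M\<^sup>2 * U) * integral {0..1} (\<lambda>t. 2 * (r t)\<^sup>2)"
proof (rule Gronwall_unit_interval[OF _ _ _ _ _ t])
  have "0 \<le> (LINT t|lebesgue_on {0..1}. (norm (u t))\<^sup>2)" by simp
  then have "0 \<le> U" using U by linarith
  then show "0 \<le> 2 * M\<^sup>2 * U" by simp
  fix t :: real assume t: "t \<in> {0..1}"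
  let ?I = "integral {0..t} (\<lambda>s. M * norm (u s) * z s)"
  have "(z t)\<^sup>2 \<le> (r t + ?I)\<^sup>2" using le[OF t] z(2)[OF t] by (intro power_mono) auto
  also have "\<dots> \<le> 2 * (r t)\<^sup>2 + 2 * ?I\<^sup>2"
    using sum_squares_bound[of "r t" ?I] by (simp add: power2_sum)
  also have "\<dots> \<le> 2 * (r t)\<^sup>2 + 2 * M\<^sup>2 * U * integral {0..t} (\<lambda>s. (z s)\<^sup>2)"
    using square_integral_M_norm_le[OF u U z(1) t] by simp
  finally show "(z t)\<^sup>2 \<le> 2 * (r t)\<^sup>2 + 2 * M\<^sup>2 * U * integral {0..t} (\<lambda>s. (z s)\<^sup>2)" .
qed (auto intro!: continuous_intros z r)

text \<open>Inserting \<open>u\<close> along \<open>Y\<close> splits the difference into a Lipschitz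
  part, absorbed by Gronwall, and the perturbation \<open>r\<close>, in which \<open>u - v\<close>
  is still integrated before norms are taken. With \<open>u = v\<close> it also gives uniqueness and
  the Lipschitz dependence on the initial point.\<close>

lemma trajectory_stability:
  assumes u: "sq_integrable u" and v: "sq_integrable v"
    and U: "(LINT t|lebesgue_on {0..1}. (norm (u t))\<^sup>2) \<le> U"
    and X: "trajectory_fun F u x X" and Y: "trajectory_fun F v y Y"
    and t: "t \<in> {0..1}"
  defines "r \<equiv> \<lambda>t. norm (x - y) + norm (integral {0..t} (control_rhs F (\<lambda>s. u s - v s) Y))"
  shows "(norm (X t - Y t))\<^sup>2 \<le>
    2 * (r t)\<^sup>2 + 2 * M\<^sup>2 * U * exp (2 * M\<^sup>2 * U) * integral {0..1} (\<lambda>t. 2 * (r t)\<^sup>2)"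
proof (rule Gronwall_control[OF u U, of "\<lambda>t. norm (X t - Y t)" r, OF _ _ _ _ t])
  have Xc: "continuous_on {0..1} X" and X': "\<And>t. t \<in> {0..1} \<Longrightarrow> X t = x + integral {0..t} (control_rhs F u X)"
    using X unfolding trajectory_fun_iff_integral[OF u] by auto
  have Yc: "continuous_on {0..1} Y" and Y': "\<And>t. t \<in> {0..1} \<Longrightarrow> Y t = y + integral {0..t} (control_rhs F v Y)"
    using Y unfolding trajectory_fun_iff_integral[OF v] by auto
  show zc: "continuous_on {0..1} (\<lambda>t. norm (X t - Y t))"
    by (intro continuous_intros Xc Yc)
  have uv: "sq_integrable (\<lambda>s. u s - v s)" by (rule sq_integrable_diff[OF u v])
  show "continuous_on {0..1} r"
    unfolding r_def
    by (intro continuous_intros indefinite_integral_continuous_1 control_rhs_integrable_on[OF uv Yc]) simp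
  fix t :: real assume t: "t \<in> {0..1}"
  then have "t \<le> 1" by simp
  note iuX = control_rhs_integrable_on[OF u Xc \<open>t \<le> 1\<close>]
    and iuY = control_rhs_integrable_on[OF u Yc \<open>t \<le> 1\<close>]
    and ivY = control_rhs_integrable_on[OF v Yc \<open>t \<le> 1\<close>]
  have "norm (integral {0..t} (\<lambda>s. control_rhs F u X s - control_rhs F u Y s)) \<le>
      integral {0..t} (\<lambda>s. M * norm (u s) * norm (X s - Y s))"
    by (rule integral_norm_bound_integral[OF Henstock_Kurzweil_Integration.integrable_diff[OF iuX iuY]
          integrable_M_norm_mult[OF u zc \<open>t \<le> 1\<close>] norm_control_rhs_diff])
  moreover have "integral {0..t} (\<lambda>s. control_rhs F u X s - control_rhs F u Y s) =
      integral {0..t} (control_rhs F u X) - integral {0..t} (control_rhs F u Y)"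
    by (rule Henstock_Kurzweil_Integration.integral_diff[OF iuX iuY])
  moreover have "integral {0..t} (control_rhs F (\<lambda>s. u s - v s) Y) =
      integral {0..t} (control_rhs F u Y) - integral {0..t} (control_rhs F v Y)"
    unfolding control_rhs_diff_left[abs_def]
    by (rule Henstock_Kurzweil_Integration.integral_diff[OF iuY ivY])
  moreover have "X t - Y t = (x - y)
      + (integral {0..t} (control_rhs F u Y) - integral {0..t} (control_rhs F v Y))
      + (integral {0..t} (control_rhs F u X) - integral {0..t} (control_rhs F u Y))"
    using X'[OF t] Y'[OF t] by simp
  moreover have "norm (p + q + w) \<le> norm p + norm q + norm w" for p q w :: 'a
    by (intro norm_triangle_mono) auto
  ultimately show "norm (X t - Y t) \<le> r t + integral {0..t} (\<lambda>s. M * norm (u s) * norm (X s - Y s))"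
    unfolding r_def by (simp only:) (meson add_left_mono order_trans)
qed simp

lemma trajectory_fun_unique:
  assumes u: "sq_integrable u" and X: "trajectory_fun F u x X" and Y: "trajectory_fun F u x Y"
    and t: "t \<in> {0..1}"
  shows "X t = Y t"
proof -
  have "control_rhs F (\<lambda>s. u s - u s) Y = (\<lambda>_. 0)" by (simp add: control_rhs_def fun_eq_iff)
  then show ?thesis using trajectory_stability[OF u u order_refl X Y t] by simp
qed

text \<open>The weight \<open>exp (lam * t)\<close> makes the integral operator a contraction on all of \<open>[0,1]\<close>.\<close>

lemma trajectory_fun_exists:
  assumes u: "sq_integrable u"
  shows "\<exists>X. trajectory_fun F u x X"
proof -
  define U where "U = (LINT t|lebesgue_on {0..1}. (norm (u t))\<^sup>2)"
  \<comment> \<open>Makes the squared contraction factor \<open>M\<^sup>2 * U / (2 * lam)\<close> at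
    most \<open>1 / 4\<close>; the summand 1 keeps \<open>lam\<close> positive.\<close>
  define lam where "lam = 2 * M\<^sup>2 * U + 1"
  have "U \<ge> 0" by (simp add: U_def)
  then have lam: "lam > 0" "M\<^sup>2 * U / (2 * lam) \<le> 1 / 4"
    by (auto simp: lam_def field_simps add_pos_nonneg)
  \<comment> \<open>The curve is \<open>W Y\<close>, so the sup norm of \<open>Y\<close> is an
    exponentially weighted norm of the curve. \<open>P\<close> is the integral operator with the
    weight removed again.\<close>
  define W where "W Y s = exp (lam * s) *\<^sub>R apply_bcontfun Y s" for Y :: "real \<Rightarrow>\<^sub>C 'a" and s
  define P where "P Y t = exp (- lam * t) *\<^sub>R (x + integral {0..t} (control_rhs F u (W Y)))" for Y t
  \<comment> \<open>Clamping time to the unit interval extends \<open>P Y\<close> to a bounded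
    continuous function on the whole line, an element of a complete space.\<close>
  define c where "c t = max 0 (min 1 t)" for t :: real
  define S where "S Y = Bcontfun (\<lambda>t. P Y (c t))" for Y
  have c: "c t \<in> {0..1}" for t by (auto simp: c_def)
  have Wc: "continuous_on A (W Y)" for Y A
    unfolding W_def by (intro continuous_intros continuous_on_apply_bcontfun)
  note int = control_rhs_integrable_on[OF u Wc]
  have Pc: "continuous_on {0..1} (P Y)" for Y
    unfolding P_def by (intro continuous_intros indefinite_integral_continuous_1 int) simp
  have S: "apply_bcontfun (S Y) t = P Y (c t)" for Y t
  proof -
    have "continuous_on UNIV (\<lambda>t. P Y (c t))"
      by (rule continuous_on_compose2[OF Pc]) (auto simp: c_def intro!: continuous_intros)
    moreover obtain B where "\<forall>t\<in>{0..1}. norm (P Y t) \<le> B"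
      using continuous_on_unit_interval_bounded[OF Pc] ..
    then have "bounded (range (\<lambda>t. P Y (c t)))" using c unfolding bounded_iff by blast
    ultimately have "(\<lambda>t. P Y (c t)) \<in> bcontfun" by (simp add: bcontfun_def)
    then show ?thesis by (simp add: S_def Bcontfun_inverse)
  qed
  have contr: "dist (S Y) (S Z) \<le> 1 / 2 * dist Y Z" for Y Z
  proof (rule dist_bound)
    fix t
    let ?s = "c t" and ?D = "dist Y Z"
    have s: "?s \<in> {0..1}" "?s \<le> 1" "0 \<le> ?s" using c[of t] by auto
    have ec: "continuous_on {0..1} (\<lambda>s. exp (lam * s))" by (intro continuous_intros)
    let ?I = "integral {0..?s} (\<lambda>s. M * norm (u s) * exp (lam * s))"
    have "((\<lambda>s. exp (2 * lam * s)) has_integral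
        exp (2 * lam * ?s) / (2 * lam) - exp (2 * lam * 0) / (2 * lam)) {0..?s}"
      using lam s by (intro fundamental_theorem_of_calculus)
        (auto intro!: derivative_eq_intros simp: has_real_derivative_iff_has_vector_derivative[symmetric])
    then have e2: "integral {0..?s} (\<lambda>s. exp (2 * lam * s)) \<le> exp (2 * lam * ?s) / (2 * lam)"
      using lam by (simp add: integral_unique)
    have sq: "(exp (lam * s))\<^sup>2 = exp (2 * lam * s)" for s
      by (simp add: exp_double[symmetric] mult.assoc)
    \<comment> \<open>Cauchy-Schwarz trades the control for the integral of the squared weight,
      whose factor \<open>1 / (2 * lam)\<close> brings the choice of \<open>lam\<close> to
      bear.\<close>
    have "?I\<^sup>2 \<le> M\<^sup>2 * U * integral {0..?s} (\<lambda>s. exp (2 * lam * s))"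
      using square_integral_M_norm_le[OF u _ ec s(1), of U] by (simp add: sq U_def)
    also have "\<dots> \<le> M\<^sup>2 * U * (exp (2 * lam * ?s) / (2 * lam))"
      using e2 \<open>U \<ge> 0\<close> by (intro mult_left_mono) auto
    also have "\<dots> = M\<^sup>2 * U / (2 * lam) * exp (2 * lam * ?s)" by simp
    also have "\<dots> \<le> 1 / 4 * exp (2 * lam * ?s)"
      using lam(2) by (intro mult_right_mono) auto
    also have "\<dots> = (exp (lam * ?s) / 2)\<^sup>2" by (simp add: power_divide sq)
    finally have I: "?I \<le> exp (lam * ?s) / 2" by (rule power2_le_imp_le) simp
    have "norm (integral {0..?s} (\<lambda>s. control_rhs F u (W Y) s - control_rhs F u (W Z) s)) \<le>
        integral {0..?s} (\<lambda>s. M * norm (u s) * exp (lam * s) * ?D)"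
    proof (rule integral_norm_bound_integral[OF Henstock_Kurzweil_Integration.integrable_diff[OF int[OF s(2)] int[OF s(2)]]])
      show "(\<lambda>s. M * norm (u s) * exp (lam * s) * ?D) integrable_on {0..?s}"
        using integrable_M_norm_mult[OF u ec s(2)] by (rule integrable_on_mult_left)
      fix s assume "s \<in> {0..?s}"
      have "norm (W Y s - W Z s) = exp (lam * s) * dist (apply_bcontfun Y s) (apply_bcontfun Z s)"
        by (simp add: W_def dist_norm flip: scaleR_diff_right)
      also have "\<dots> \<le> exp (lam * s) * ?D" by (intro mult_left_mono dist_bounded) auto
      finally have "norm (W Y s - W Z s) \<le> exp (lam * s) * ?D" .
      then have "M * norm (u s) * norm (W Y s - W Z s) \<le> M * norm (u s) * (exp (lam * s) * ?D)"
        by (intro mult_left_mono) (auto simp: M_nonneg)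
      with norm_control_rhs_diff[of u "W Y" s "W Z"]
      show "norm (control_rhs F u (W Y) s - control_rhs F u (W Z) s) \<le> M * norm (u s) * exp (lam * s) * ?D"
        by (simp add: mult.assoc)
    qed
    also have "\<dots> = ?I * ?D" by simp
    also have "\<dots> \<le> exp (lam * ?s) / 2 * ?D" using I by (intro mult_right_mono) auto
    finally have *: "norm (integral {0..?s} (control_rhs F u (W Y)) - integral {0..?s} (control_rhs F u (W Z)))
        \<le> exp (lam * ?s) / 2 * ?D"
      using Henstock_Kurzweil_Integration.integral_diff[OF int[OF s(2)] int[OF s(2)], of Y Z] by simp
    have "dist (apply_bcontfun (S Y) t) (apply_bcontfun (S Z) t) = exp (- lam * ?s) *
        norm (integral {0..?s} (control_rhs F u (W Y)) - integral {0..?s} (control_rhs F u (W Z)))"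
      by (simp add: S P_def dist_norm flip: scaleR_diff_right)
    also have "\<dots> \<le> exp (- lam * ?s) * (exp (lam * ?s) / 2 * ?D)"
      using * by (intro mult_left_mono) auto
    also have "\<dots> = 1 / 2 * ?D" by (simp add: exp_minus)
    finally show "dist (apply_bcontfun (S Y) t) (apply_bcontfun (S Z) t) \<le> 1 / 2 * ?D" .
  qed
  have "\<exists>!Y. S Y = Y"
    by (rule banach_fix_type[of "1 / 2"]) (use contr in auto)
  then obtain Y where Y: "S Y = Y" by blast
  have "W Y t = x + integral {0..t} (control_rhs F u (W Y))" if t: "t \<in> {0..1}" for t
  proof -
    have "c t = t" using t by (auto simp: c_def)
    then have "apply_bcontfun Y t = P Y t" using S[of Y t] Y by simp
    then have "W Y t = exp (lam * t) *\<^sub>R P Y t" by (simp add: W_def)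
    then show ?thesis by (simp add: P_def exp_minus)
  qed
  then have "trajectory_fun F u x (W Y)"
    using Wc by (simp add: trajectory_fun_iff_integral[OF u])
  then show ?thesis by blast
qed

section \<open>The endpoint map: Lipschitz bound and weak continuity\<close>

lemma flow_abs_L2:
  assumes u: "sq_integrable u" and X: "trajectory_fun F u x X"
  shows "flow F (abs_L2 u) x = X 1"
  unfolding flow_def trajectory.abs_eq[OF L2_rel_refl[OF u]]
  using X by (intro the_equality) (auto dest: trajectory_fun_unique[OF u X, of _ 1])

text \<open>The root of the stability constant for equal controls: there \<open>r\<close> is the
  constant \<open>norm (x - y)\<close>, which contributes the 2 directly and the 4 through the
  integral. It depends on the control through the bound \<open>U\<close> only.\<close>

definition flow_lipschitz_const where
  "flow_lipschitz_const U = sqrt (2 + 4 * M\<^sup>2 * U * exp (2 * M\<^sup>2 * U))"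

lemma flow_lipschitz:
  assumes U: "(norm u)\<^sup>2 \<le> U"
  shows "(flow_lipschitz_const U)-lipschitz_on UNIV (flow F u)"
proof (rule lipschitz_onI)
  have "0 \<le> U" using U zero_le_power2[of "norm u"] by linarith
  then show nonneg: "0 \<le> flow_lipschitz_const U" by (simp add: flow_lipschitz_const_def)
  fix x y
  obtain f where f: "sq_integrable f" and uf: "u = abs_L2 f" by (rule L2_cases)
  obtain X Y where X: "trajectory_fun F f x X" and Y: "trajectory_fun F f y Y"
    using trajectory_fun_exists[OF f] by meson
  have "control_rhs F (\<lambda>s. f s - f s) Y = (\<lambda>_. 0)" by (simp add: control_rhs_def fun_eq_iff)
  then have "(norm (X 1 - Y 1))\<^sup>2 \<le>
      2 * (norm (x - y))\<^sup>2 + 2 * M\<^sup>2 * U * exp (2 * M\<^sup>2 * U) * (2 * (norm (x - y))\<^sup>2)"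
    using trajectory_stability[OF f f _ X Y, of U 1] U f by (simp add: uf norm_abs_L2)
  also have "\<dots> = (flow_lipschitz_const U * norm (x - y))\<^sup>2"
    using \<open>0 \<le> U\<close> by (simp add: flow_lipschitz_const_def power_mult_distrib algebra_simps)
  finally have "norm (X 1 - Y 1) \<le> flow_lipschitz_const U * norm (x - y)"
    by (rule power2_le_imp_le) (simp add: nonneg)
  then show "dist (flow F u x) (flow F u y) \<le> flow_lipschitz_const U * dist x y"
    by (simp add: uf flow_abs_L2[OF f X] flow_abs_L2[OF f Y] dist_norm)
qed

text \<open>Each coordinate of the integrated perturbation is an inner product with an element of
  \<open>L2\<close> that does not depend on \<open>w\<close>; this element is the test function for
  weak convergence.\<close>

lemma inner_integral_control_rhs:
  assumes w: "sq_integrable w" and Y: "continuous_on {0..1} Y" and t: "t \<le> 1"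
  shows "integral {0..t} (control_rhs F w Y) \<bullet> b =
    abs_L2 w \<bullet> abs_L2 (\<lambda>s. indicator {0..t} s *\<^sub>R (\<chi> i. F i (Y s) \<bullet> b))"
proof -
  have hc: "continuous_on {0..1} (\<lambda>s. \<chi> i. F i (Y s) \<bullet> b)"
    by (intro continuous_intros continuous_on_F_comp Y)
  then have h: "sq_integrable (\<lambda>s. indicator {0..t} s *\<^sub>R (\<chi> i. F i (Y s) \<bullet> b))"
    by (intro sq_integrable_indicator sq_integrable_continuous)
  have eq: "w s \<bullet> (indicator {0..t} s *\<^sub>R (\<chi> i. F i (Y s) \<bullet> b)) =
      indicator {0..t} s *\<^sub>R (control_rhs F w Y s \<bullet> b)" for s
    by (simp add: inner_vec_def control_rhs_def inner_sum_left sum_distrib_left mult.left_commute)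
  have "integral {0..t} (control_rhs F w Y) \<bullet> b = integral {0..t} (\<lambda>s. control_rhs F w Y s \<bullet> b)"
    using control_rhs_integrable_on[OF w Y t] by (rule integral_component_eq[symmetric])
  also have "\<dots> = (LINT s|lebesgue_on {0..1}. indicator {0..t} s *\<^sub>R (control_rhs F w Y s \<bullet> b))"
    using sq_integrable_integrable_inner[OF w h] t unfolding eq by (rule integral_indicator_unit[symmetric])
  finally show ?thesis unfolding inner_abs_L2[OF w h] eq .
qed

text \<open>Supplies a dominating constant, uniform in \<open>t\<close> and on bounded sets of
  controls; for this the crude estimate of a norm by 1 plus its square is enough.\<close>

lemma norm_integral_control_rhs_le:
  assumes Y: "continuous_on {0..1} Y"
  shows "\<exists>D. \<forall>w. sq_integrable w \<longrightarrow>
    (\<forall>t\<in>{0..1}. norm (integral {0..t} (control_rhs F w Y)) \<le> D * (1 + (norm (abs_L2 w))\<^sup>2))"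
proof -
  have "continuous_on {0..1} (\<lambda>s. \<Sum>i\<in>UNIV. norm (F i (Y s)))"
    by (intro continuous_intros continuous_on_F_comp Y)
  then obtain D where "\<forall>s\<in>{0..1}. norm (\<Sum>i\<in>UNIV. norm (F i (Y s))) \<le> D"
    using continuous_on_unit_interval_bounded by blast
  then have D: "(\<Sum>i\<in>UNIV. norm (F i (Y s))) \<le> D" if "s \<in> {0..1}" for s
    using that by fastforce
  have "0 \<le> (\<Sum>i\<in>UNIV. norm (F i (Y 0)))" by (intro sum_nonneg) auto
  then have "0 \<le> D" using D[of 0] by simp
  have "norm (integral {0..t} (control_rhs F w Y)) \<le> D * (1 + (norm (abs_L2 w))\<^sup>2)"
    if w: "sq_integrable w" and t: "t \<in> {0..1}" for w t
  proof -
    have t1: "t \<le> 1" and sub: "{0..t} \<subseteq> {0..1}" using t by auto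
    have i: "(\<lambda>s. D * (1 + (norm (w s))\<^sup>2)) integrable_on {0..t'}" if "t' \<le> 1" for t'
      using sq_integrable_integrable_on(2)[OF w that]
      by (intro integrable_on_mult_right integrable_add) auto
    have "norm (control_rhs F w Y s) \<le> D * (1 + (norm (w s))\<^sup>2)" if s: "s \<in> {0..t}" for s
    proof -
      have "norm (control_rhs F w Y s) \<le> (\<Sum>i\<in>UNIV. norm (w s) * norm (F i (Y s)))"
        unfolding control_rhs_def
        by (intro sum_norm_le) (auto intro!: mult_right_mono simp: component_le_norm_cart)
      also have "\<dots> = norm (w s) * (\<Sum>i\<in>UNIV. norm (F i (Y s)))" by (simp add: sum_distrib_left)
      also have "\<dots> \<le> (1 + (norm (w s))\<^sup>2) * D"
      proof (rule mult_mono)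
        show "norm (w s) \<le> 1 + (norm (w s))\<^sup>2"
          using sum_squares_bound[of 1 "norm (w s)"] norm_ge_zero[of "w s"] by (simp del: norm_ge_zero)
        show "(\<Sum>i\<in>UNIV. norm (F i (Y s))) \<le> D" using s sub by (intro D) blast
      qed (auto intro: sum_nonneg)
      finally show ?thesis by (simp add: mult.commute)
    qed
    then have "norm (integral {0..t} (control_rhs F w Y)) \<le> integral {0..t} (\<lambda>s. D * (1 + (norm (w s))\<^sup>2))"
      by (rule integral_norm_bound_integral[OF control_rhs_integrable_on[OF w Y t1] i[OF t1]])
    also have "\<dots> \<le> integral {0..1} (\<lambda>s. D * (1 + (norm (w s))\<^sup>2))"
      using \<open>0 \<le> D\<close> by (intro integral_subset_le[OF sub i[OF t1] i[OF order_refl]]) auto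
    also have "\<dots> = D * (1 + integral {0..1} (\<lambda>s. (norm (w s))\<^sup>2))"
      using sq_integrable_integrable_on(2)[OF w order_refl]
        Henstock_Kurzweil_Integration.integral_add[OF integrable_const_ivl[of 1 0 1], of "\<lambda>s. (norm (w s))\<^sup>2"]
      by simp
    also have "integral {0..1} (\<lambda>s. (norm (w s))\<^sup>2) = (norm (abs_L2 w))\<^sup>2"
      using w unfolding norm_abs_L2[OF w] sq_integrable_def
      by (intro lebesgue_integral_eq_integral[symmetric]) auto
    finally show ?thesis .
  qed
  then show ?thesis by blast
qed

text \<open>The stability bound contains the perturbation only at time 1 and in the mean square.
  Weak convergence makes it vanish at each fixed time, and dominated convergence does the
  rest.\<close>

lemma flow_tendsto_weak:
  assumes U: "\<And>n. (norm (u n))\<^sup>2 \<le> U"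
    and weak: "\<And>h. (\<lambda>n. u n \<bullet> h) \<longlonglongrightarrow> v \<bullet> h"
  shows "(\<lambda>n. flow F (u n) x) \<longlonglongrightarrow> flow F v x"
proof -
  have "\<exists>f. sq_integrable f \<and> u n = abs_L2 f" for n
    by (rule L2_cases[of "u n"]) blast
  then obtain f where f: "\<And>n. sq_integrable (f n)" and uf: "\<And>n. u n = abs_L2 (f n)" by metis
  obtain g where g: "sq_integrable g" and vg: "v = abs_L2 g" by (rule L2_cases)
  have "\<forall>n. \<exists>X. trajectory_fun F (f n) x X" using trajectory_fun_exists[OF f] by blast
  then have "\<exists>X. \<forall>n. trajectory_fun F (f n) x (X n)" by (rule choice)
  then obtain X where X: "\<And>n. trajectory_fun F (f n) x (X n)" by blast
  obtain Y where Y: "trajectory_fun F g x Y" using trajectory_fun_exists[OF g] by blast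
  have Yc: "continuous_on {0..1} Y" using Y unfolding trajectory_fun_iff_integral[OF g] by blast
  define w where "w = (\<lambda>n s. f n s - g s)"
  have w: "sq_integrable (w n)" for n
    unfolding w_def by (rule sq_integrable_diff[OF f g])
  have uv: "abs_L2 (w n) = u n - v" for n
    unfolding w_def uf vg by (rule minus_L2.abs_eq[symmetric]) (simp_all add: L2_rel_refl f g)
  define r where "r n t = norm (integral {0..t} (control_rhs F (w n) Y))" for n t
  have rc: "continuous_on {0..1} (r n)" for n
    unfolding r_def
    by (intro continuous_intros indefinite_integral_continuous_1 control_rhs_integrable_on[OF w Yc]) simp
  have r0: "(\<lambda>n. r n t) \<longlonglongrightarrow> 0" if t: "t \<in> {0..1}" for t
  proof -
    have "(\<lambda>n. integral {0..t} (control_rhs F (w n) Y)) \<longlonglongrightarrow> 0"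
    proof (subst tendsto_componentwise_iff, intro ballI)
      fix b :: 'a assume "b \<in> Basis"
      let ?h = "abs_L2 (\<lambda>s. indicator {0..t} s *\<^sub>R (\<chi> i. F i (Y s) \<bullet> b))"
      have "(\<lambda>n. (u n - v) \<bullet> ?h) \<longlonglongrightarrow> 0"
        using tendsto_diff[OF weak[of ?h] tendsto_const[of "v \<bullet> ?h"]] by (simp add: inner_diff_left)
      then show "(\<lambda>n. integral {0..t} (control_rhs F (w n) Y) \<bullet> b) \<longlonglongrightarrow> 0 \<bullet> b"
        using t by (simp add: inner_integral_control_rhs[OF w Yc] uv)
    qed
    then show ?thesis unfolding r_def by (rule tendsto_norm_zero)
  qed
  obtain D where D: "\<And>w t. sq_integrable w \<Longrightarrow> t \<in> {0..1} \<Longrightarrow>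
      norm (integral {0..t} (control_rhs F w Y)) \<le> D * (1 + (norm (abs_L2 w))\<^sup>2)"
    using norm_integral_control_rhs_le[OF Yc] by blast
  have "0 \<le> D" using D[OF sq_integrable_zero, of 0] 
    by (smt (verit) atLeastAtMost_iff mult_neg_pos norm_ge_zero zero_le_power2)
  \<comment> \<open>\<open>sqrt U + norm v\<close> bounds \<open>norm (u n - v)\<close> for all
    \<open>n\<close> at once.\<close>
  define R where "R = D * (1 + (sqrt U + norm v)\<^sup>2)"
  have rR: "r n t \<le> R" if t: "t \<in> {0..1}" for n t
  proof -
    have "norm (u n - v) \<le> norm (u n) + norm v" by (rule norm_triangle_ineq4)
    also have "\<dots> \<le> sqrt U + norm v" using U[of n] by (simp add: real_le_rsqrt)
    finally have "D * (1 + (norm (u n - v))\<^sup>2) \<le> R"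
      unfolding R_def using \<open>0 \<le> D\<close> by (intro mult_left_mono add_left_mono power_mono) auto
    then show ?thesis using D[OF w t, of n] by (simp add: r_def uv)
  qed
  have "(\<lambda>n. integral {0..1} (\<lambda>t. 2 * (r n t)\<^sup>2)) \<longlonglongrightarrow> integral {0..1} (\<lambda>t :: real. 0 :: real)"
  proof (rule dominated_convergence(2))
    show "(\<lambda>t. 2 * (r n t)\<^sup>2) integrable_on {0..1}" for n
      by (intro integrable_continuous_real continuous_intros rc)
    show "norm (2 * (r n t)\<^sup>2) \<le> 2 * R\<^sup>2" if "t \<in> {0..1}" for n t
      using power_mono[OF rR[OF that], of n 2] by (simp add: r_def)
    show "(\<lambda>n. 2 * (r n t)\<^sup>2) \<longlonglongrightarrow> 0" if "t \<in> {0..1}" for t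
      using tendsto_mult[OF tendsto_const[of 2] tendsto_power[OF r0[OF that], of 2]] by simp
  qed (rule integrable_const_ivl)
  then have int0: "(\<lambda>n. integral {0..1} (\<lambda>t. 2 * (r n t)\<^sup>2)) \<longlonglongrightarrow> 0" by simp
  have le: "(norm (X n 1 - Y 1))\<^sup>2 \<le> 2 * (r n 1)\<^sup>2 +
      2 * M\<^sup>2 * U * exp (2 * M\<^sup>2 * U) * integral {0..1} (\<lambda>t. 2 * (r n t)\<^sup>2)" for n
    using trajectory_stability[OF f g _ X Y, of n U 1] U[of n]
    by (simp add: uf norm_abs_L2[OF f] r_def w_def)
  have "(\<lambda>n. (norm (X n 1 - Y 1))\<^sup>2) \<longlonglongrightarrow> 0"
  proof (rule tendsto_sandwich[OF _ _ tendsto_const])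
    show "(\<lambda>n. 2 * (r n 1)\<^sup>2 +
        2 * M\<^sup>2 * U * exp (2 * M\<^sup>2 * U) * integral {0..1} (\<lambda>t. 2 * (r n t)\<^sup>2)) \<longlonglongrightarrow> 0"
      using tendsto_add[OF tendsto_mult[OF tendsto_const[of 2] tendsto_power[OF r0[of 1], of 2]]
          tendsto_mult[OF tendsto_const[of "2 * M\<^sup>2 * U * exp (2 * M\<^sup>2 * U)"] int0]] by simp
  qed (use le in auto)
  then have "(\<lambda>n. sqrt ((norm (X n 1 - Y 1))\<^sup>2)) \<longlonglongrightarrow> sqrt 0" by (rule tendsto_real_sqrt)
  then have "(\<lambda>n. X n 1 - Y 1) \<longlonglongrightarrow> 0" by (simp add: tendsto_norm_zero_iff)
  then have "(\<lambda>n. X n 1) \<longlonglongrightarrow> Y 1" by (simp add: LIM_zero_iff)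
  then show ?thesis by (simp add: uf vg flow_abs_L2[OF f X] flow_abs_L2[OF g Y])
qed

end

section \<open>Weak topology and weakly convergent measures\<close>

text \<open>The inner product with \<open>h\<close> is a bounded functional, hence one coordinate of
  the product whose topology is pulled back.\<close>

lemma limitin_weak_topology_imp_inner:
  fixes v :: "'a::real_inner"
  assumes "limitin weak_topology u v F"
  shows "((\<lambda>n. u n \<bullet> h) \<longlongrightarrow> v \<bullet> h) F"
proof -
  have "continuous_map (weak_topology :: 'a topology) euclideanreal
      ((\<lambda>f. f (blinfun_inner_left h)) \<circ> (\<lambda>u (l :: 'a \<Rightarrow>\<^sub>L real). blinfun_apply l u))"
    unfolding weak_topology_def
    by (intro continuous_map_pullback continuous_map_product_projection) simp
  from continuous_map_limit[OF this assms] show ?thesis by (simp add: o_def)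
qed

lemma topspace_weak_topology [simp]: "topspace weak_topology = UNIV"
  by (simp add: weak_topology_def topspace_pullback_topology)

section \<open>Integrals against measures carried by a compact set\<close>

lemma AE_in_measure_support:
  fixes M :: "'a::second_countable_topology measure"
  assumes "sets M = sets borel"
  shows "AE z in M. z \<in> measure_support M"
proof -
  define \<U> where "\<U> = {U. open U \<and> emeasure M U = 0}"
  \<comment> \<open>The complement of the support is the union of all open null sets; by Lindelof
    countably many of them have the same union, which is therefore null.\<close>
  obtain \<V> where \<V>: "\<V> \<subseteq> \<U>" "countable \<V>" "\<Union>\<V> = \<Union>\<U>"
    using Lindelof[of \<U>] by (auto simp: \<U>_def)
  have "V \<in> null_sets M" if "V \<in> \<V>" for V
    using that \<V>(1) assms by (auto simp: \<U>_def null_sets_def)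
  then have "\<Union>\<V> \<in> null_sets M"
    using null_sets_UN'[OF \<V>(2), of "\<lambda>V. V" M] by simp
  moreover have "\<Union>\<V> = - measure_support M"
    unfolding \<V>(3) by (auto simp: \<U>_def measure_support_def)
  ultimately have "- measure_support M \<in> null_sets M" by simp
  from AE_not_in[OF this] show ?thesis by simp
qed

text \<open>Pointwise convergence on a finite net is uniform there, and the common Lipschitz
  constant carries it to the points in between.\<close>

lemma uniform_limit_lipschitz_compact:
  fixes f :: "nat \<Rightarrow> 'a::metric_space \<Rightarrow> 'b::metric_space"
  assumes K: "compact K" and f: "\<And>n. \<Lambda>-lipschitz_on K (f n)" and g: "\<Lambda>-lipschitz_on K g"
    and lim: "\<And>x. x \<in> K \<Longrightarrow> (\<lambda>n. f n x) \<longlonglongrightarrow> g x"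
  shows "uniform_limit K f g sequentially"
proof (rule uniform_limitI)
  fix e :: real assume "e > 0"
  have "\<Lambda> \<ge> 0" using g by (rule lipschitz_on_nonneg)
  \<comment> \<open>The 1 added to \<Lambda> keeps the denominator positive when \<Lambda> is
    0.\<close>
  define d where "d = e / (3 * (\<Lambda> + 1))"
  have "d > 0" using \<open>e > 0\<close> \<open>\<Lambda> \<ge> 0\<close> by (simp add: d_def)
  have d: "\<Lambda> * d \<le> e / 3" using \<open>e > 0\<close> \<open>\<Lambda> \<ge> 0\<close> by (simp add: d_def field_simps)
  obtain T where T: "T \<subseteq> K" "finite T" "K \<subseteq> (\<Union>x\<in>T. ball x d)"
    using compactE_image[OF K, of K "\<lambda>x. ball x d"] \<open>d > 0\<close> by (metis UN_I centre_in_ball open_ball subsetI)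
  have "\<forall>\<^sub>F n in sequentially. \<forall>x\<in>T. dist (f n x) (g x) < e / 3"
    using T \<open>e > 0\<close> tendstoD[OF lim, of _ "e / 3"] by (intro eventually_ball_finite) auto
  then show "\<forall>\<^sub>F n in sequentially. \<forall>x\<in>K. dist (f n x) (g x) < e"
  proof eventually_elim
    case (elim n)
    show ?case
    proof
      fix x assume x: "x \<in> K"
      then obtain y where y: "y \<in> T" "dist x y < d" using T(3) by (auto simp: dist_commute)
      have "\<Lambda> * dist x y \<le> e / 3" using y d \<open>\<Lambda> \<ge> 0\<close> by (meson less_imp_le mult_left_mono order_trans)
      then have "dist (f n x) (f n y) \<le> e / 3" "dist (g x) (g y) \<le> e / 3"
        using lipschitz_onD[OF f x, of y n] lipschitz_onD[OF g x, of y] y T(1) by (auto intro: order_trans)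
      moreover have "dist (f n y) (g y) < e / 3" using elim y by blast
      ultimately show "dist (f n x) (g x) < e"
        using dist_triangle[of "f n x" "g x" "f n y"] dist_triangle[of "f n y" "g x" "g y"]
          dist_commute[of "g x" "g y"] by linarith
    qed
  qed
qed


lemma integrable_continuous_AE_compact:
  fixes f :: "'a::topological_space \<Rightarrow> real"
  assumes "finite_measure M" "sets M = sets borel" "continuous_on UNIV f"
    and C: "compact C" "AE z in M. z \<in> C"
  shows "integrable M f"
proof -
  have "compact (f ` C)"
    using C(1) assms(3) by (intro compact_continuous_image) (auto intro: continuous_on_subset)
  then obtain B where B: "\<forall>z\<in>C. norm (f z) \<le> B"
    using compact_imp_bounded[OF \<open>compact (f ` C)\<close>] by (auto simp: bounded_iff)
  show ?thesis
  proof (rule finite_measure.integrable_const_bound[OF assms(1)])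
    show "AE z in M. norm (f z) \<le> B" using C(2) B by (auto elim: eventually_mono)
    show "f \<in> borel_measurable M"
      using borel_measurable_continuous_onI[OF assms(3)] measurable_cong_sets[OF assms(2) refl] by blast
  qed
qed

text \<open>A bounded continuous \<open>h\<close> equal to \<open>g\<close> on \<open>C\<close> is
  tested against the measures; the error \<open>f n - h\<close> is uniformly small on
  \<open>C\<close>, which carries all the mass. The conditions on \<open>\<mu> n\<close> are
  eventual so that finitely many indices may violate them.\<close>

lemma integral_weakly_converges_uniform_limit:
  fixes f :: "nat \<Rightarrow> 'a::topological_space \<Rightarrow> real"
  assumes prob: "\<forall>\<^sub>F n in sequentially. prob_space (\<mu> n)" "prob_space \<nu>"
    and sets: "\<forall>\<^sub>F n in sequentially. sets (\<mu> n) = sets borel" "sets \<nu> = sets borel"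
    and C: "compact C" "\<forall>\<^sub>F n in sequentially. AE z in \<mu> n. z \<in> C" "AE z in \<nu>. z \<in> C"
    and weak: "weakly_converges \<mu> \<nu>"
    and f: "\<And>n. continuous_on UNIV (f n)" and g: "continuous_on UNIV g"
    and lim: "uniform_limit C f g sequentially"
  shows "(\<lambda>n. LINT z|\<mu> n. f n z) \<longlonglongrightarrow> (LINT z|\<nu>. g z)"
proof -
  have "compact (g ` C)"
    using C(1) g by (intro compact_continuous_image) (auto intro: continuous_on_subset)
  then obtain B where B: "\<forall>z\<in>C. \<bar>g z\<bar> \<le> B"
    using compact_imp_bounded[OF \<open>compact (g ` C)\<close>] by (auto simp: bounded_iff)
  \<comment> \<open>The absolute value of \<open>B\<close> keeps the clamping interval nonempty even
    if \<open>C\<close> is empty and \<open>B\<close> negative.\<close>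
  define h where "h z = max (- \<bar>B\<bar>) (min (g z) \<bar>B\<bar>)" for z
  have h: "continuous_on UNIV h"
    unfolding h_def by (intro continuous_intros g)
  have hg: "h z = g z" if "z \<in> C" for z using B that by (force simp: h_def)
  have "\<bar>h z\<bar> \<le> \<bar>B\<bar>" for z by (auto simp: h_def)
  then have "bounded (range h)" by (auto simp: bounded_iff)
  with weak h have "(\<lambda>n. LINT z|\<mu> n. h z) \<longlonglongrightarrow> (LINT z|\<nu>. h z)"
    unfolding weakly_converges_def by blast
  also have "(LINT z|\<nu>. h z) = (LINT z|\<nu>. g z)"
  proof (rule integral_cong_AE)
    have "k \<in> borel_measurable \<nu>" if "continuous_on UNIV k" for k :: "'a \<Rightarrow> real"
      using borel_measurable_continuous_onI[OF that] measurable_cong_sets[OF sets(2) refl] by blast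
    then show "h \<in> borel_measurable \<nu>" "g \<in> borel_measurable \<nu>" using h g by blast+
    show "AE z in \<nu>. h z = g z" using C(3) by eventually_elim (rule hg)
  qed
  finally have 1: "(\<lambda>n. LINT z|\<mu> n. h z) \<longlonglongrightarrow> (LINT z|\<nu>. g z)" .
  have 2: "(\<lambda>n. (LINT z|\<mu> n. f n z) - (LINT z|\<mu> n. h z)) \<longlonglongrightarrow> 0"
  proof (rule tendstoI)
    fix e :: real assume "e > 0"
    then have "\<forall>\<^sub>F n in sequentially. \<forall>z\<in>C. dist (f n z) (g z) < e / 2"
      by (intro uniform_limitD[OF lim]) simp
    then show "\<forall>\<^sub>F n in sequentially. dist ((LINT z|\<mu> n. f n z) - (LINT z|\<mu> n. h z)) 0 < e"
      using prob(1) sets(1) C(2)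
    proof eventually_elim
      case (elim n)
      interpret prob_space "\<mu> n" by fact
      note int = integrable_continuous_AE_compact[OF finite_measure_axioms elim(3) _ C(1) elim(4)]
      have fh: "integrable (\<mu> n) (\<lambda>z. f n z - h z)"
        by (intro Bochner_Integration.integrable_diff int f h)
      have "AE z in \<mu> n. norm (f n z - h z) \<le> e / 2"
        using elim(4)
      proof eventually_elim
        case (elim z)
        then show ?case using \<open>\<forall>z\<in>C. dist (f n z) (g z) < e / 2\<close> hg by (force simp: dist_real_def)
      qed
      then have "(LINT z|\<mu> n. norm (f n z - h z)) \<le> e / 2"
        using integral_mono_AE[OF integrable_norm[OF fh], of "\<lambda>_. e / 2"] prob_space by simp
      then have "norm (LINT z|\<mu> n. f n z - h z) \<le> e / 2"
        using integral_norm_bound[of "\<mu> n" "\<lambda>z. f n z - h z"] by linarith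
      then show ?case
        using \<open>e > 0\<close> Bochner_Integration.integral_diff[OF int[OF f] int[OF h]] by simp
    qed
  qed
  show ?thesis using tendsto_add[OF 2 1] by simp
qed

lemma uniform_limit_compose_bounded:
  fixes a :: "'a::heine_borel \<Rightarrow> 'b::metric_space" and \<phi> :: "'d \<Rightarrow> 'c \<Rightarrow> 'a"
  assumes "continuous_on UNIV a" "uniform_limit S \<phi> \<psi> F" "bounded (\<psi> ` S)"
  shows "uniform_limit S (\<lambda>n x. a (\<phi> n x)) (\<lambda>x. a (\<psi> x)) F"
proof (rule uniform_limitI)
  fix e :: real assume "e > 0"
  obtain p R where R: "\<forall>x\<in>S. dist p (\<psi> x) \<le> R"
    using assms(3) by (auto simp: bounded_def)
  \<comment> \<open>The radius is enlarged by 1 so that the ball also contains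
    \<open>\<phi> n x\<close> once it is within distance 1 of \<open>\<psi> x\<close>; hence
    \<open>min d 1\<close> below.\<close>
  have "uniformly_continuous_on (cball p (R + 1)) a"
    using assms(1) by (intro compact_uniformly_continuous) (auto intro: continuous_on_subset)
  then obtain d where "d > 0" and d: "\<And>x y. x \<in> cball p (R + 1) \<Longrightarrow> y \<in> cball p (R + 1) \<Longrightarrow>
      dist y x < d \<Longrightarrow> dist (a y) (a x) < e"
    using \<open>e > 0\<close> unfolding uniformly_continuous_on_def by meson
  have "\<forall>\<^sub>F n in F. \<forall>x\<in>S. dist (\<phi> n x) (\<psi> x) < min d 1"
    using \<open>d > 0\<close> by (intro uniform_limitD[OF assms(2)]) simp
  then show "\<forall>\<^sub>F n in F. \<forall>x\<in>S. dist (a (\<phi> n x)) (a (\<psi> x)) < e"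
  proof eventually_elim
    case (elim n)
    show ?case
    proof
      fix x assume "x \<in> S"
      then have "dist (\<phi> n x) (\<psi> x) < d" "dist (\<phi> n x) (\<psi> x) < 1" "dist p (\<psi> x) \<le> R"
        using elim R by auto
      then show "dist (a (\<phi> n x)) (a (\<psi> x)) < e"
        using dist_triangle2[of p "\<phi> n x" "\<psi> x"] by (intro d) auto
    qed
  qed
qed


text \<open>Replaces the weak topology by convergence of inner products. One direction of this
  passage is enough, because the only sequences whose weak convergence has to be produced are
  constant.\<close>

lemma gamma_convergesI:
  fixes c :: "nat \<Rightarrow> 'a::real_inner \<Rightarrow> real"
  assumes "k \<ge> 0"
    and lim: "\<And>u v. (\<And>n. u n \<in> S) \<Longrightarrow> v \<in> S \<Longrightarrow> (\<And>h. (\<lambda>n. u n \<bullet> h) \<longlonglongrightarrow> v \<bullet> h) \<Longrightarrow>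
      (\<lambda>n. c n (u n)) \<longlonglongrightarrow> c' v"
  shows "gamma_converges (subtopology weak_topology S)
    (\<lambda>n u. ereal (c n u + k * (norm u)\<^sup>2)) (\<lambda>u. ereal (c' u + k * (norm u)\<^sup>2))"
  unfolding gamma_converges_def
proof (intro conjI allI impI ballI)
  fix u v assume "range u \<subseteq> topspace (subtopology weak_topology S) \<and>
    limitin (subtopology weak_topology S) u v sequentially"
  then have u: "u n \<in> S" and v: "v \<in> S" and "limitin weak_topology u v sequentially" for n
    by (auto simp: limitin_subtopology)
  then have weak: "(\<lambda>n. u n \<bullet> h) \<longlonglongrightarrow> v \<bullet> h" for h
    by (intro limitin_weak_topology_imp_inner)
  \<comment> \<open>The squared norm is replaced by its affine minorant at \<open>v\<close>,
    obtained from \<open>0 \<le> (norm (u n - v))\<^sup>2\<close>. It is weakly continuous and exact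
    at \<open>v\<close>, so \<open>b\<close> converges to the limit cost.\<close>
  define b where "b n = c n (u n) + k * (2 * (u n \<bullet> v) - (norm v)\<^sup>2)" for n
  have "b \<longlonglongrightarrow> c' v + k * (2 * (v \<bullet> v) - (norm v)\<^sup>2)"
    unfolding b_def by (intro tendsto_intros lim u v weak)
  then have "b \<longlonglongrightarrow> c' v + k * (norm v)\<^sup>2" by (simp add: power2_norm_eq_inner)
  then have "(\<lambda>n. ereal (b n)) \<longlonglongrightarrow> ereal (c' v + k * (norm v)\<^sup>2)" by simp
  then have "ereal (c' v + k * (norm v)\<^sup>2) = liminf (\<lambda>n. ereal (b n))"
    by (intro lim_imp_Liminf[symmetric]) auto
  also have "\<dots> \<le> liminf (\<lambda>n. ereal (c n (u n) + k * (norm (u n))\<^sup>2))"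
  proof (intro Liminf_mono always_eventually allI)
    fix n
    have "0 \<le> (norm (u n - v))\<^sup>2" by simp
    then have "2 * (u n \<bullet> v) - (norm v)\<^sup>2 \<le> (norm (u n))\<^sup>2"
      by (simp add: power2_norm_eq_inner inner_diff_left inner_diff_right inner_commute)
    then show "ereal (b n) \<le> ereal (c n (u n) + k * (norm (u n))\<^sup>2)"
      unfolding b_def using \<open>k \<ge> 0\<close> by (simp add: mult_left_mono)
  qed
  finally show "ereal (c' v + k * (norm v)\<^sup>2) \<le> liminf (\<lambda>n. ereal (c n (u n) + k * (norm (u n))\<^sup>2))" .
next
  fix v :: 'a assume "v \<in> topspace (subtopology weak_topology S)"
  then have v: "v \<in> S" by simp
  have "(\<lambda>n. c n v + k * (norm v)\<^sup>2) \<longlonglongrightarrow> c' v + k * (norm v)\<^sup>2"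
    using lim[of "\<lambda>_. v" v] v by (intro tendsto_intros) auto
  then have "(\<lambda>n. ereal (c n v + k * (norm v)\<^sup>2)) \<longlonglongrightarrow> ereal (c' v + k * (norm v)\<^sup>2)" by simp
  then have "limsup (\<lambda>n. ereal (c n v + k * (norm v)\<^sup>2)) = ereal (c' v + k * (norm v)\<^sup>2)"
    by (intro lim_imp_Limsup) auto
  then show "\<exists>u. range u \<subseteq> topspace (subtopology weak_topology S) \<and>
      limitin (subtopology weak_topology S) u v sequentially \<and>
      limsup (\<lambda>n. ereal (c n (u n) + k * (norm (u n))\<^sup>2)) \<le> ereal (c' v + k * (norm v)\<^sup>2)"
    using v by (intro exI[of _ "\<lambda>_. v"]) (auto simp: limitin_const_iff)
qed

theorem theorem3p4:
  fixes F :: "'k::finite \<Rightarrow> real ^ 'n::finite \<Rightarrow> real ^ 'n"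
    and a :: "(real ^ 'n) \<times> (real ^ 'n) \<Rightarrow> real"
    and \<gamma> :: "enat \<Rightarrow> ((real ^ 'n) \<times> (real ^ 'n)) measure"
    and K :: "(real ^ 'n) set"
    and \<beta> C :: real
  assumes F_smooth: "\<And>i. smooth (F i)"
    and F_lipschitz: "\<And>i. \<exists>L. L-lipschitz_on UNIV (F i)"
    and \<beta>_pos: "\<beta> > 0"
    and a_C1: "C_k 1 a"
    and a_nonneg: "\<And>z. a z \<ge> 0"
    and \<gamma>_prob: "\<And>N. N \<ge> 1 \<Longrightarrow> prob_space (\<gamma> N)"
    and \<gamma>_borel: "\<And>N. N \<ge> 1 \<Longrightarrow> sets (\<gamma> N) = sets borel"
    and \<gamma>_conv: "weakly_converges (\<lambda>N. \<gamma> (enat N)) (\<gamma> \<infinity>)"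
    and K_compact: "compact K"
    and \<gamma>_support: "\<And>N. N \<ge> 1 \<Longrightarrow> measure_support (\<gamma> N) \<subseteq> K \<times> K"
    and C_pos: "C > 0"
    and C_bound: "\<And>N u. N \<ge> 1 \<Longrightarrow> is_arg_min (cost F a \<beta> (\<gamma> N)) (\<lambda>_. True) u \<Longrightarrow>
      (norm u)\<^sup>2 \<le> C / \<beta>"
  shows "gamma_converges (subtopology weak_topology {u. (norm u)\<^sup>2 \<le> C / \<beta>})
    (\<lambda>N u. ereal (cost F a \<beta> (\<gamma> (enat N)) u)) (\<lambda>u. ereal (cost F a \<beta> (\<gamma> \<infinity>) u))"
  unfolding cost_def
proof (rule gamma_convergesI)
  show "0 \<le> \<beta> / 2" using \<beta>_pos by simp
next
  fix u :: "nat \<Rightarrow> (real ^ 'k) L2" and v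
  assume u: "\<And>n. u n \<in> {u. (norm u)\<^sup>2 \<le> C / \<beta>}" and v: "v \<in> {u. (norm u)\<^sup>2 \<le> C / \<beta>}"
    and weak: "\<And>h. (\<lambda>n. u n \<bullet> h) \<longlonglongrightarrow> v \<bullet> h"
  obtain l where l: "\<And>i. (l i)-lipschitz_on UNIV (F i)" using F_lipschitz by metis
  \<comment> \<open>There are finitely many fields, so the largest of their constants serves all of
    them.\<close>
  interpret lipschitz_fields F "Max (range l)"
    by unfold_locales (rule lipschitz_on_mono[OF l], auto)
  define \<Lambda> where "\<Lambda> = flow_lipschitz_const (C / \<beta>)"
  have lip: "\<Lambda>-lipschitz_on A (flow F (u n))" "\<Lambda>-lipschitz_on A (flow F v)" for n A
    using flow_lipschitz u v lipschitz_on_subset unfolding \<Lambda>_def by blast+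
  have cont: "continuous_on UNIV (\<lambda>z. (flow F w (fst z), snd z))" if "\<Lambda>-lipschitz_on UNIV (flow F w)" for w
    using lipschitz_on_continuous_on[OF that]
    by (intro continuous_intros continuous_on_compose2[of UNIV "flow F w" UNIV fst]) auto
  have "uniform_limit K (\<lambda>n. flow F (u n)) (flow F v) sequentially"
    using u weak by (intro uniform_limit_lipschitz_compact[OF K_compact lip] flow_tendsto_weak) auto
  \<comment> \<open>The second component is left unchanged, so the distance of the pairs is that of
    the flows.\<close>
  then have unif: "uniform_limit (K \<times> K) (\<lambda>n z. (flow F (u n) (fst z), snd z))
      (\<lambda>z. (flow F v (fst z), snd z)) sequentially"
    unfolding uniform_limit_iff by (fastforce simp: dist_Pair_Pair elim: eventually_mono)
  have KK: "compact (K \<times> K)" using K_compact by (rule compact_Times) (rule K_compact)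
  have bdd: "bounded ((\<lambda>z. (flow F v (fst z), snd z)) ` (K \<times> K))"
    by (intro compact_imp_bounded compact_continuous_image KK continuous_on_subset[OF cont[OF lip(2)]]) simp
  have a: "continuous_on UNIV a"
    using a_C1
    by (intro continuous_at_imp_continuous_on ballI differentiable_imp_continuous_within)
      (simp only: One_nat_def C_k.simps)
  from uniform_limit_compose_bounded[OF a unif bdd]
  have unif: "uniform_limit (K \<times> K) (\<lambda>n z. a (flow F (u n) (fst z), snd z))
      (\<lambda>z. a (flow F v (fst z), snd z)) sequentially"
    by simp
  \<comment> \<open>The measures are constrained from index 1 on, while sequences start at 0; index
    0 disappears in the eventual conditions.\<close>
  have one: "enat n \<ge> 1" if "n \<ge> 1" for n using that by (simp add: one_enat_def)
  have supp: "AE z in \<gamma> N. z \<in> K \<times> K" if "N \<ge> 1" for N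
    using AE_in_measure_support[OF \<gamma>_borel[OF that]] \<gamma>_support[OF that] by (auto elim: eventually_mono)
  have ac: "continuous_on UNIV (\<lambda>z. a (flow F w (fst z), snd z))" if "\<Lambda>-lipschitz_on UNIV (flow F w)" for w
    by (rule continuous_on_compose2[OF a cont[OF that]]) simp
  have "(\<lambda>n. LINT z|\<gamma> (enat n). a (flow F (u n) (fst z), snd z)) \<longlonglongrightarrow>
      (LINT z|\<gamma> \<infinity>. a (flow F v (fst z), snd z))"
  proof (rule integral_weakly_converges_uniform_limit[OF _ _ _ _ KK _ _ \<gamma>_conv ac[OF lip(1)] ac[OF lip(2)] unif])
    show "\<forall>\<^sub>F n in sequentially. prob_space (\<gamma> (enat n))"
      "\<forall>\<^sub>F n in sequentially. sets (\<gamma> (enat n)) = sets borel"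
      "\<forall>\<^sub>F n in sequentially. AE z in \<gamma> (enat n). z \<in> K \<times> K"
      using \<gamma>_prob \<gamma>_borel supp one by (auto intro!: eventually_sequentiallyI[of 1])
  qed (rule \<gamma>_prob \<gamma>_borel supp, simp)+
  then show "(\<lambda>n. LINT (x, y)|\<gamma> (enat n). a (flow F (u n) x, y)) \<longlonglongrightarrow>
      (LINT (x, y)|\<gamma> \<infinity>. a (flow F v x, y))"
    by (simp add: case_prod_beta')
qed

end
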